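(* Let $k\ge 1$ and let $\pi$ be a permutation of $[k]$. Then $$\beta(\pi)=\min_{0\le a<b\le 1}\left\{\frac{1}{b-a}+\frac{1}{b-a}\int_a^b\left(\frac{\beta(L(\pi))}{x}+\frac{\beta(R(\pi))}{1-x}\right)dx\right\},$$ where terms coming from empty subpermutations are omitted from the integrand.
   Context: $[k]=\{1,\dots,k\}$; $\Pi_k$ is the set of permutations of $[k]$, with $\Pi_0=\{\emptyset\}$. Let $X_1,X_2,\dots$ be i.i.d. uniform on $[0,1]$ (the stream). Two finite sequences $(u_1,\dots,u_k)$, $(v_1,\dots,v_k)$ are order-isomorphic if $u_i<u_j\Leftrightarrow v_i<v_j$ for all $i,j$. For $\pi\in\Pi_k$, $k\ge1$, $\mathrm{OA}(\pi)$ is the set of online embedding algorithms for $\pi$: sequences of stopping times $1\le\tau_1<\dots<\tau_k$ with respect to the natural filtration $\sigma(X_1,\dots,X_t)$, $t\ge 0$, such that $(X_{\tau_1},\dots,X_{\tau_k})$ is almost surely order-isomorphic to $(\pi(1),\dots,\pi(k))$. Define $\beta(\pi):=\inf_{(\tau_1,\dots,\tau_k)\in\mathrm{OA}(\pi)}\mathbb E[\tau_k]$ and $\beta(\emptyset):=0$. For $\pi\in\Pi_k$, $L(\pi)\in\Pi_{\pi(1)-1}$ and $R(\pi)\in\Pi_{k-\pi(1)}$ are the unique permutations order-isomorphic to $(\pi(j):j\in[k],\ \pi(j)<\pi(1))$ and $(\pi(j):j\in[k],\ \pi(j)>\pi(1))$ (with the order of indices $j$ kept). The integral is an improper integral that may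 equal $+\infty$; by convention $\beta(\emptyset)/0:=0$. *)

theory Defs
  imports "HOL-Probability.Probability" "HOL-Combinatorics.Multiset_Permutations"
begin

text \<open>A permutation of \<open>[k]\<close> is given in one-line notation, as an element
  \<open>[\<pi>(1), \<dots>, \<pi>(k)]\<close> of \<open>permutations_of_set {1..k}\<close>; the empty permutation is \<open>[]\<close>.
  Lists are indexed from 0, so \<open>\<pi>(i)\<close> is \<open>\<pi> ! (i - 1)\<close>.\<close>

definition order_isomorphic :: "'a::linorder list \<Rightarrow> 'b::linorder list \<Rightarrow> bool" where
  "order_isomorphic u v \<longleftrightarrow> length u = length v \<and>
     (\<forall>i<length u. \<forall>j<length u. u ! i < u ! j \<longleftrightarrow> v ! i < v ! j)"

definition standardization :: "nat list \<Rightarrow> nat list" where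
  "standardization u = (THE \<sigma>. \<sigma> \<in> permutations_of_set {1..length u} \<and> order_isomorphic \<sigma> u)"

definition left_perm :: "nat list \<Rightarrow> nat list" where
  "left_perm \<pi> = standardization (filter (\<lambda>v. v < hd \<pi>) \<pi>)"

definition right_perm :: "nat list \<Rightarrow> nat list" where
  "right_perm \<pi> = standardization (filter (\<lambda>v. v > hd \<pi>) \<pi>)"

text \<open>The stream is \<open>X 1, X 2, \<dots>\<close>; \<open>X 0\<close> is not used. The index type is \<^typ>\<open>enat\<close> because a
  stopping time may be infinite on a null set, and the library's \<^const>\<open>stopping_time\<close> takes its
  values in the index type of the filtration. The condition at \<open>\<infinity>\<close> is vacuous.\<close>

definition natural_filtration ::
    "'a measure \<Rightarrow> (nat \<Rightarrow> 'a \<Rightarrow> real) \<Rightarrow> enat \<Rightarrow> 'a measure" where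
  "natural_filtration M X t =
     sigma (space M) {X i -` B \<inter> space M | i B. 1 \<le> i \<and> enat i \<le> t \<and> B \<in> sets borel}"

text \<open>The \<open>\<tau>\<^sub>i\<close> are strictly increasing at every point of the sample space, with the convention
  that \<open>\<tau>\<^sub>i = \<infinity>\<close> forces \<open>\<tau>\<^sub>j = \<infinity>\<close> for \<open>j > i\<close>. Finiteness everywhere cannot be demanded:
  already the first visit of the stream to \<open>(1/2, 1]\<close> is finite only almost surely.\<close>

definition online_algorithms ::
    "'a measure \<Rightarrow> (nat \<Rightarrow> 'a \<Rightarrow> real) \<Rightarrow> nat list \<Rightarrow> ('a \<Rightarrow> enat) list set" where
  "online_algorithms M X \<pi> = {\<tau>s. length \<tau>s = length \<pi> \<and>
     (\<forall>\<tau>\<in>set \<tau>s. stopping_time (natural_filtration M X) \<tau>) \<and>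
     (\<forall>\<omega>\<in>space M. (\<forall>\<tau>\<in>set \<tau>s. 1 \<le> \<tau> \<omega>) \<and>
        sorted_wrt (\<lambda>\<sigma> \<tau>. \<sigma> \<omega> < \<tau> \<omega> \<or> \<sigma> \<omega> = \<infinity> \<and> \<tau> \<omega> = \<infinity>) \<tau>s) \<and>
     (AE \<omega> in M. (\<forall>\<tau>\<in>set \<tau>s. \<tau> \<omega> \<noteq> \<infinity>) \<and>
        order_isomorphic (map (\<lambda>\<tau>. X (the_enat (\<tau> \<omega>)) \<omega>) \<tau>s) \<pi>)}"

definition beta :: "'a measure \<Rightarrow> (nat \<Rightarrow> 'a \<Rightarrow> real) \<Rightarrow> nat list \<Rightarrow> ennreal" where
  "beta M X \<pi> = (if \<pi> = [] then 0 else
     (INF \<tau>s\<in>online_algorithms M X \<pi>. \<integral>\<^sup>+ \<omega>. ennreal_of_enat (last \<tau>s \<omega>) \<partial>M))"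

text \<open>Well-definedness of \<^const>\<open>standardization\<close> and the explicit form of \<open>L(\<pi>)\<close>, \<open>R(\<pi>)\<close>.\<close>

lemma perm_entry_rank:
  assumes "\<sigma> \<in> permutations_of_set {1..k}" "i < k"
  shows "\<sigma> ! i = Suc (card {j. j < k \<and> \<sigma> ! j < \<sigma> ! i})"
proof -
  have s: "set \<sigma> = {1..k}" and d: "distinct \<sigma>"
    using assms(1) by (auto simp: permutations_of_set_def)
  have l: "length \<sigma> = k" using distinct_card[OF d] s by simp
  have m: "\<sigma> ! i \<in> {1..k}" using nth_mem[of i \<sigma>] assms(2) l s by simp
  have "(\<lambda>j. \<sigma> ! j) ` {j. j < k \<and> \<sigma> ! j < \<sigma> ! i} = {x \<in> set \<sigma>. x < \<sigma> ! i}"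
    using l by (auto simp: in_set_conv_nth)
  also have "\<dots> = {1..<\<sigma> ! i}" using s m by auto
  finally have "card ((\<lambda>j. \<sigma> ! j) ` {j. j < k \<and> \<sigma> ! j < \<sigma> ! i}) = \<sigma> ! i - 1" by simp
  moreover have "inj_on (\<lambda>j. \<sigma> ! j) {j. j < k \<and> \<sigma> ! j < \<sigma> ! i}"
    using d l by (auto simp: inj_on_def nth_eq_iff_index_eq)
  ultimately show ?thesis using m by (simp add: card_image)
qed

lemma standardization_eqI:
  assumes "\<sigma> \<in> permutations_of_set {1..length u}" "order_isomorphic \<sigma> u"
  shows "standardization u = \<sigma>"
  unfolding standardization_def
proof (rule the_equality)
  fix \<rho> assume \<rho>: "\<rho> \<in> permutations_of_set {1..length u} \<and> order_isomorphic \<rho> u"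
  have l: "length \<rho> = length u" "length \<sigma> = length u"
    using \<rho> assms(2) by (auto simp: order_isomorphic_def)
  show "\<rho> = \<sigma>"
  proof (rule nth_equalityI)
    fix i assume i: "i < length \<rho>"
    have "{j. j < length u \<and> \<rho> ! j < \<rho> ! i} = {j. j < length u \<and> \<sigma> ! j < \<sigma> ! i}"
      using \<rho> assms(2) i l by (auto simp: order_isomorphic_def)
    thus "\<rho> ! i = \<sigma> ! i"
      using perm_entry_rank[of \<rho> "length u" i] perm_entry_rank[of \<sigma> "length u" i] \<rho> assms(1) i l
      by simp
  qed (use l in simp)
qed (use assms in simp)

lemma
  assumes \<pi>: "\<pi> \<in> permutations_of_set {1..k}" and k: "k \<ge> 1"
  shows left_perm_eq: "left_perm \<pi> = filter (\<lambda>v. v < hd \<pi>) \<pi>"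
    and right_perm_eq: "right_perm \<pi> = map (\<lambda>v. v - hd \<pi>) (filter (\<lambda>v. v > hd \<pi>) \<pi>)"
    and left_perm_permutation: "left_perm \<pi> \<in> permutations_of_set {1..hd \<pi> - 1}"
    and right_perm_permutation: "right_perm \<pi> \<in> permutations_of_set {1..k - hd \<pi>}"
proof -
  have s: "set \<pi> = {1..k}" and d: "distinct \<pi>"
    using \<pi> by (auto simp: permutations_of_set_def)
  have "\<pi> \<noteq> []" using s k by auto
  then have h: "hd \<pi> \<in> {1..k}" using hd_in_set[of \<pi>] s by simp
  let ?l = "filter (\<lambda>v. v < hd \<pi>) \<pi>" and ?r = "filter (\<lambda>v. v > hd \<pi>) \<pi>"
  let ?r' = "map (\<lambda>v. v - hd \<pi>) ?r"
  have sl: "set ?l = {1..hd \<pi> - 1}" and sr: "set ?r = {hd \<pi> + 1..k}"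
    using s h by auto
  have ll: "length ?l = hd \<pi> - 1"
    using distinct_card[of ?l] d sl by simp
  have lr: "length ?r = k - hd \<pi>"
    using distinct_card[of ?r] d sr by simp
  have pl: "?l \<in> permutations_of_set {1..hd \<pi> - 1}"
    using sl d by (simp add: permutations_of_set_def)
  have "(\<lambda>v. v - hd \<pi>) ` {hd \<pi> + 1..k} = {1..k - hd \<pi>}"
  proof (intro equalityI subsetI)
    fix x assume "x \<in> {1..k - hd \<pi>}"
    then have "x + hd \<pi> \<in> {hd \<pi> + 1..k}" by auto
    thus "x \<in> (\<lambda>v. v - hd \<pi>) ` {hd \<pi> + 1..k}" by (rule rev_image_eqI) simp
  qed auto
  then have sr': "set ?r' = {1..k - hd \<pi>}" using sr by (simp only: set_map)
  have dr': "distinct ?r'"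
    using d by (auto simp: distinct_map inj_on_def)
  have pr: "?r' \<in> permutations_of_set {1..k - hd \<pi>}"
    using sr' dr' unfolding permutations_of_set_def by blast
  have gt: "?r ! i > hd \<pi>" if "i < length ?r" for i
    using nth_mem[OF that] by simp
  have "?r ! i - hd \<pi> < ?r ! j - hd \<pi> \<longleftrightarrow> ?r ! i < ?r ! j" if "i < length ?r" "j < length ?r" for i j
    using gt[OF that(1)] gt[OF that(2)] by linarith
  then have "order_isomorphic ?r' ?r"
    by (auto simp: order_isomorphic_def)
  then show r: "right_perm \<pi> = ?r'"
    unfolding right_perm_def using pr lr by (intro standardization_eqI) auto
  show l: "left_perm \<pi> = ?l"
    unfolding left_perm_def using pl ll
    by (intro standardization_eqI) (auto simp: order_isomorphic_def)
  show "left_perm \<pi> \<in> permutations_of_set {1..hd \<pi> - 1}" using l pl by simp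
  show "right_perm \<pi> \<in> permutations_of_set {1..k - hd \<pi>}" using r pr by simp
qed

end

theory Submission
  imports Defs
begin

text \<open>After some entries of \<open>\<pi>\<close> have been embedded, the chosen values cut the unit interval into gaps,
and every remaining entry must land in one particular gap, the one delimited by the values of its
neighbours in rank. The proof attaches a cost to every gap and shows that the sum of these costs is
the expected remaining time under optimal play.

Let \<open>v\<close> (\<open>pattern_cost\<close>) be given by \<open>v([]) = 0\<close> and, for a pattern with smaller entries \<open>L\<close> and
larger entries \<open>R\<close> after its head, by the level \<open>c\<close> with
\<open>\<integral>\<^sub>0\<^sup>1 max 0 (c - v(L)/y - v(R)/(1-y)) dy = 1\<close> (\<open>stop_level\<close>). The potential of a state is the sum
over its gaps of \<open>v\<close> of the pattern still to be embedded there, divided by the length of the gap.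
If the next entry belongs to the gap \<open>(a, b)\<close>, placing it at relative position \<open>y\<close> changes only
that gap and lowers the potential by \<open>(c - v(L)/y - v(R)/(1-y)) / (b - a)\<close>. A uniform sample hits
the gap with probability \<open>b - a\<close>, so the equation for \<open>c\<close> says that in every state the positive
part of the drop offered by the next sample has expectation exactly 1
(\<open>potential_drop_integral\<close>, \<open>expected_gain\<close>).

This one fact gives both bounds. Under any algorithm the potential falls from \<open>v(\<pi>)\<close> to 0, so
\<open>v(\<pi>)\<close> is at most the sum of the positive parts offered up to time \<open>\<tau>\<^sub>k\<close>, whose expectation is
\<open>E \<tau>\<^sub>k\<close> (\<open>pattern_cost_lower\<close>). The greedy algorithm, which accepts a sample exactly when the
potential strictly drops, collects every positive part, and the total collected never exceeds
\<open>v(\<pi>)\<close> because the potential stays nonnegative; so its expected duration is at most \<open>v(\<pi>)\<close>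
(\<open>pattern_cost_upper\<close>). Hence \<open>\<beta> = v\<close>, without conditioning on \<open>\<tau>\<^sub>1\<close> or splitting the stream into
subsequences, and every sum in the argument has nonnegative terms, so no integrability is at stake.

It remains to recognise \<open>c\<close> as the minimum. Put \<open>V y = v(L)/y + v(R)/(1-y)\<close>. For every \<open>a < b\<close>,
\<open>c (b - a) - \<integral>\<^sub>a\<^sup>b V \<le> \<integral> max 0 (c - V) = 1\<close>, which is \<open>c \<le> (1 + \<integral>\<^sub>a\<^sup>b V) / (b - a)\<close>; equality holds
when \<open>(a, b)\<close> is the set \<open>{V < c}\<close>, which is an interval because \<open>V\<close> is convex
(\<open>stop_level_lower\<close>, \<open>stop_level_attained\<close>).\<close>

section \<open>The one-step stopping problem\<close>

definition split_cost :: "real \<Rightarrow> real \<Rightarrow> real \<Rightarrow> real" where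
  "split_cost l r y = l / y + r / (1 - y)"

lemma split_cost_measurable [measurable]: "split_cost l r \<in> borel_measurable borel"
  unfolding split_cost_def by measurable

lemma split_cost_nonneg: "0 \<le> l \<Longrightarrow> 0 \<le> r \<Longrightarrow> y \<in> {0<..<1} \<Longrightarrow> 0 \<le> split_cost l r y"
  by (simp add: split_cost_def)

lemma convex_split_cost:
  assumes "0 \<le> l" "0 \<le> r"
  shows "convex_on {0<..<1} (split_cost l r)"
proof -
  have c: "convex_on {0<..<1::real} (\<lambda>y. 1 / y)"
    by (rule convex_on_subset[OF convex_on_inverse[of "{0<..}", unfolded inverse_eq_divide]])
       (auto)
  have d: "convex_on {0<..<1::real} (\<lambda>y. 1 / (1 - y))"
  proof (rule convex_onI)
    fix t x y :: real
    assume t: "0 < t" "t < 1" and x: "x \<in> {0<..<1}" and y: "y \<in> {0<..<1}"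
    have e: "1 - ((1 - t) * x + t * y) = (1 - t) * (1 - x) + t * (1 - y)"
      by (simp add: algebra_simps)
    show "1 / (1 - ((1 - t) *\<^sub>R x + t *\<^sub>R y)) \<le> (1 - t) * (1 / (1 - x)) + t * (1 / (1 - y))"
      using convex_onD[OF c, of t "1 - x" "1 - y"] t x y by (simp add: e)
  qed (auto)
  have "convex_on {0<..<1} (\<lambda>y. l * (1 / y) + r * (1 / (1 - y)))"
    by (intro convex_on_add convex_on_cmul c d assms)
  thus ?thesis by (simp add: split_cost_def[abs_def])
qed

text \<open>The left-hand side is a Lipschitz function of \<open>c\<close>, as the positive part is a contraction; it
vanishes at 0 and exceeds 1 for large \<open>c\<close>, so the intermediate value theorem applies.\<close>

lemma stop_level_exists:
  assumes "0 \<le> l" "0 \<le> r"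
  shows "\<exists>c>0. (\<integral>\<^sup>+y\<in>{0<..<1}. ennreal (c - split_cost l r y) \<partial>lborel) = 1"
proof -
  define f where "f c y = indicator {0<..<1} y * max 0 (c - split_cost l r y)" for c y :: real
  define H where "H c = (\<integral>y. f c y \<partial>lborel)" for c
  have f0: "0 \<le> f c y" for c y by (auto simp: f_def indicator_def)
  have fm [measurable]: "f c \<in> borel_measurable borel" for c unfolding f_def by measurable
  have i1: "integrable lborel (\<lambda>y::real. indicator {0<..<1} y * d)" for d :: real
    by (intro integrable_mult_left integrable_real_indicator) (simp_all add: emeasure_lborel_Ioo)
  have fb: "norm (f c y) \<le> norm (indicator {0<..<1} y * \<bar>c\<bar>)" for c y
    using split_cost_nonneg[OF assms, of y] by (auto simp: f_def indicator_def)
  have fi: "integrable lborel (f c)" for c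
    by (rule Bochner_Integration.integrable_bound[OF i1[of "\<bar>c\<bar>"]]) (use fb in auto)
  have lip: "\<bar>H c - H d\<bar> \<le> \<bar>c - d\<bar>" for c d
  proof -
    have "\<bar>H c - H d\<bar> = \<bar>\<integral>y. f c y - f d y \<partial>lborel\<bar>"
      unfolding H_def by (subst Bochner_Integration.integral_diff[OF fi fi]) simp
    also have "\<dots> \<le> (\<integral>y. \<bar>f c y - f d y\<bar> \<partial>lborel)"
      by (rule integral_abs_bound)
    also have "\<dots> \<le> integral\<^sup>L lborel (\<lambda>y::real. indicator {0<..<1} y * \<bar>c - d\<bar>)"
      by (rule integral_mono'[OF i1]) (auto simp: f_def indicator_def)
    also have "\<dots> = \<bar>c - d\<bar>" by simp
    finally show ?thesis .
  qed
  have cont: "continuous_on UNIV H"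
    unfolding continuous_on_iff
  proof (intro ballI allI impI)
    fix x e :: real assume "0 < e"
    thus "\<exists>d>0. \<forall>x'\<in>UNIV. dist x' x < d \<longrightarrow> dist (H x') (H x) < e"
      by (intro exI[of _ e]) (auto simp: dist_real_def intro: le_less_trans[OF lip])
  qed
  have H0: "H 0 = 0"
  proof -
    have "f 0 = (\<lambda>y. 0)"
      using split_cost_nonneg[OF assms] by (intro ext) (auto simp: f_def indicator_def)
    thus ?thesis by (simp add: H_def)
  qed
  \<comment> \<open>On the middle half of the interval both denominators are at least 1/4, so at this level the
    positive part is at least 2 there.\<close>
  define C where "C = 4 * l + 4 * r + 2"
  have C1: "1 \<le> H C"
  proof -
    have "1 = (\<integral>y. indicator {1/4..3/4::real} y * (2::real) \<partial>lborel)" by simp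
    also have "\<dots> \<le> H C" unfolding H_def
    proof (rule integral_mono'[OF fi])
      fix y :: real
      have "split_cost l r y \<le> 4 * l + 4 * r" if "1/4 \<le> y" "y \<le> 3/4"
      proof -
        have "l / y \<le> l / (1/4)" by (rule divide_left_mono) (use that assms in auto)
        moreover have "r / (1 - y) \<le> r / (1/4)"
          by (rule divide_left_mono) (use that assms in auto)
        ultimately show ?thesis by (simp add: split_cost_def)
      qed
      thus "indicator {1/4..3/4::real} y * (2::real) \<le> f C y"
        using f0[of C y] by (auto simp: f_def C_def indicator_def)
    qed (rule f0)
    finally show ?thesis .
  qed
  have "\<exists>c. 0 \<le> c \<and> c \<le> C \<and> H c = 1"
    by (rule IVT') (use H0 C1 assms in \<open>auto simp: C_def intro: continuous_on_subset[OF cont]\<close>)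
  then obtain c where c: "0 \<le> c" "H c = 1" by blast
  have "(\<integral>\<^sup>+y\<in>{0<..<1}. ennreal (c - split_cost l r y) \<partial>lborel) = (\<integral>\<^sup>+y. ennreal (f c y) \<partial>lborel)"
    by (intro nn_integral_cong) (auto simp: f_def indicator_def max_def ennreal_neg)
  also have "\<dots> = ennreal (H c)"
    unfolding H_def by (rule nn_integral_eq_integral[OF fi]) (simp add: f0)
  finally show ?thesis using c H0 by (intro exI[of _ c]) (auto simp: less_le)
qed

text \<open>The value of the following stopping problem: samples arrive at unit cost each, and stopping at
the sample \<open>y\<close> costs \<open>split_cost l r y\<close>. Continuing from level \<open>c\<close> is fair exactly when the
expected improvement offered by one sample equals its unit cost. In the integral, \<open>ennreal\<close>
truncates negative values, so the integrand is a positive part.\<close>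

definition stop_level :: "real \<Rightarrow> real \<Rightarrow> real" where
  "stop_level l r = (SOME c. 0 < c \<and>
     (\<integral>\<^sup>+y\<in>{0<..<1}. ennreal (c - split_cost l r y) \<partial>lborel) = 1)"

lemma stop_level:
  assumes "0 \<le> l" "0 \<le> r"
  shows stop_level_pos: "0 < stop_level l r"
    and stop_level_eq: "(\<integral>\<^sup>+y\<in>{0<..<1}. ennreal (stop_level l r - split_cost l r y) \<partial>lborel) = 1"
  using someI_ex[OF stop_level_exists[OF assms]] unfolding stop_level_def by auto

text \<open>Integrate \<open>c \<le> max 0 (c - V) + V\<close> over the interval, where \<open>V\<close> is the split cost.\<close>

lemma stop_level_lower:
  assumes "0 \<le> l" "0 \<le> r" "0 \<le> a" "a < b" "b \<le> 1"
  shows "ennreal (stop_level l r) * ennreal (b - a) \<le>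
           1 + (\<integral>\<^sup>+y\<in>{a<..<b}. ennreal (split_cost l r y) \<partial>lborel)"
proof -
  let ?c = "stop_level l r"
  have "ennreal ?c * ennreal (b - a) = (\<integral>\<^sup>+y\<in>{a<..<b}. ennreal ?c \<partial>lborel)"
    using assms by (simp add: nn_integral_cmult_indicator)
  also have "\<dots> \<le> (\<integral>\<^sup>+y. ennreal (?c - split_cost l r y) * indicator {0<..<1} y +
                       ennreal (split_cost l r y) * indicator {a<..<b} y \<partial>lborel)"
  proof (intro nn_integral_mono)
    fix y
    have "ennreal ?c \<le> ennreal (?c - split_cost l r y) + ennreal (split_cost l r y)"
      by (simp add: ennreal_leI ennreal_plus_if)
    thus "ennreal ?c * indicator {a<..<b} y \<le> ennreal (?c - split_cost l r y) * indicator {0<..<1} y +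
            ennreal (split_cost l r y) * indicator {a<..<b} y"
      using assms by (auto simp: indicator_def)
  qed
  also have "\<dots> = 1 + (\<integral>\<^sup>+y\<in>{a<..<b}. ennreal (split_cost l r y) \<partial>lborel)"
    using stop_level_eq[OF assms(1,2)] by (subst nn_integral_add) auto
  finally show ?thesis .
qed

text \<open>On the set \<open>{V < c}\<close> the inequality \<open>c \<le> max 0 (c - V) + V\<close> is an equality, and this set
carries the whole integral of the positive part. By convexity of \<open>V\<close> it is an interval up to its
end points.\<close>

lemma stop_level_attained:
  assumes "0 \<le> l" "0 \<le> r"
  obtains a b where "0 \<le> a" "a < b" "b \<le> 1"
    "ennreal (stop_level l r) * ennreal (b - a) =
       1 + (\<integral>\<^sup>+y\<in>{a<..<b}. ennreal (split_cost l r y) \<partial>lborel)"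
proof -
  let ?c = "stop_level l r"
  define A where "A = {y \<in> {0<..<1}. split_cost l r y < ?c}"
  have eq1: "(\<integral>\<^sup>+y\<in>A. ennreal (?c - split_cost l r y) \<partial>lborel) = 1"
    unfolding stop_level_eq[OF assms, symmetric]
    by (intro nn_integral_cong) (auto simp: A_def indicator_def ennreal_neg)
  define a b where "a = Inf A" and "b = Sup A"
  have ne: "A \<noteq> {}" using eq1 by auto
  have bdd: "bdd_below A" "bdd_above A"
    by (auto simp: A_def intro!: bdd_belowI[of _ 0] bdd_aboveI[of _ 1])
  have sub: "A \<subseteq> {a..b}"
    unfolding a_def b_def using bdd by (auto intro: cInf_lower cSup_upper)
  have a0: "0 \<le> a" unfolding a_def by (rule cInf_greatest[OF ne]) (auto simp: A_def)
  have b1: "b \<le> 1" unfolding b_def by (rule cSup_least[OF ne]) (auto simp: A_def)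
  have conv: "convex A"
    unfolding convex_def
  proof (intro ballI allI impI)
    fix x y u v :: real
    assume xy: "x \<in> A" "y \<in> A" and uv: "0 \<le> u" "0 \<le> v" "u + v = 1"
    have "u *\<^sub>R x + v *\<^sub>R y \<in> {0<..<1}"
      using xy uv convexD[OF convex_real_interval(8)[of 0 1], of x y u v] by (auto simp: A_def)
    moreover have "split_cost l r (u *\<^sub>R x + v *\<^sub>R y) \<le> max (split_cost l r x) (split_cost l r y)"
      by (rule convex_lower[OF convex_split_cost[OF assms]]) (use xy uv in \<open>auto simp: A_def\<close>)
    ultimately show "u *\<^sub>R x + v *\<^sub>R y \<in> A"
      using xy by (auto simp: A_def)
  qed
  have sup: "{a<..<b} \<subseteq> A"
  proof
    fix y assume y: "y \<in> {a<..<b}"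
    obtain u where u: "u \<in> A" "u < y" using y ne bdd unfolding a_def by (auto simp: cInf_less_iff)
    obtain w where w: "w \<in> A" "y < w" using y ne bdd unfolding b_def by (auto simp: less_cSup_iff)
    have "closed_segment u w \<subseteq> A" using conv u w by (simp add: convex_contains_segment)
    moreover have "y \<in> closed_segment u w" using u w by (simp add: closed_segment_eq_real_ivl1)
    ultimately show "y \<in> A" by blast
  qed
  have ae: "AE y in lborel. y \<in> A \<longleftrightarrow> y \<in> {a<..<b}"
    using AE_lborel_singleton[of a] AE_lborel_singleton[of b]
  proof eventually_elim
    case (elim y) thus ?case using sub sup by fastforce
  qed
  have eq2: "(\<integral>\<^sup>+y\<in>{a<..<b}. ennreal (?c - split_cost l r y) \<partial>lborel) = 1"
    unfolding eq1[symmetric]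
    by (rule nn_integral_cong_AE) (use ae in \<open>eventually_elim, auto simp: indicator_def\<close>)
  have ab: "a < b"
  proof (rule ccontr)
    assume "\<not> a < b" hence "{a<..<b} = {}" by auto
    with eq2 show False by simp
  qed
  have "ennreal ?c * ennreal (b - a) = (\<integral>\<^sup>+y\<in>{a<..<b}. ennreal ?c \<partial>lborel)"
    using ab by (simp add: nn_integral_cmult_indicator)
  also have "\<dots> = (\<integral>\<^sup>+y. ennreal (?c - split_cost l r y) * indicator {a<..<b} y +
                       ennreal (split_cost l r y) * indicator {a<..<b} y \<partial>lborel)"
  proof (intro nn_integral_cong)
    fix y
    have "ennreal ?c = ennreal (?c - split_cost l r y) + ennreal (split_cost l r y)" if "y \<in> {a<..<b}"
    proof -
      have "y \<in> A" using that sup by blast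
      hence "0 \<le> split_cost l r y" "split_cost l r y < ?c"
        using split_cost_nonneg[OF assms, of y] by (auto simp: A_def)
      thus ?thesis by (subst ennreal_plus[symmetric]) auto
    qed
    thus "ennreal ?c * indicator {a<..<b} y = ennreal (?c - split_cost l r y) * indicator {a<..<b} y +
            ennreal (split_cost l r y) * indicator {a<..<b} y"
      by (auto simp: indicator_def)
  qed
  also have "\<dots> = 1 + (\<integral>\<^sup>+y\<in>{a<..<b}. ennreal (split_cost l r y) \<partial>lborel)"
    using eq2 by (subst nn_integral_add) auto
  finally show ?thesis using that a0 ab b1 by blast
qed

section \<open>Pattern costs and the potential of a partial embedding\<close>

fun pattern_cost :: "nat list \<Rightarrow> real" where
  "pattern_cost [] = 0"
| "pattern_cost (p # ps) =
     stop_level (pattern_cost (filter (\<lambda>q. q < p) ps)) (pattern_cost (filter (\<lambda>q. p < q) ps))"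

lemma pattern_cost_nonneg: "0 \<le> pattern_cost ps"
  by (induction ps rule: pattern_cost.induct) (auto intro: less_imp_le stop_level_pos)

text \<open>The right subpermutation has its entries shifted down to start at 1; this lets the recursion
work with the sublist of larger entries itself.\<close>

lemma pattern_cost_map:
  "strict_mono_on (set ps) f \<Longrightarrow> pattern_cost (map f ps) = pattern_cost ps"
proof (induction ps rule: pattern_cost.induct)
  case (2 p ps)
  have f: "f q < f p \<longleftrightarrow> q < p" "f p < f q \<longleftrightarrow> p < q" if "q \<in> set ps" for q
    using 2(3) that by (auto simp: strict_mono_on_less)
  have "filter (\<lambda>q. q < f p) (map f ps) = map f (filter (\<lambda>q. q < p) ps)"
    "filter (\<lambda>q. f p < q) (map f ps) = map f (filter (\<lambda>q. p < q) ps)"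
    using f by (auto simp: filter_map o_def cong: filter_cong)
  moreover have "strict_mono_on (set (filter P ps)) f" for P
    using 2(3) by (auto simp: strict_mono_on_def)
  ultimately show ?case using 2(1,2) by simp
qed simp

text \<open>In what follows, \<open>us\<close> lists the entries embedded so far together with their values, and \<open>ws\<close>
lists the entries still to come, both in the order of the pattern. The implication below suffices
for order isomorphism because the entries are distinct.\<close>

definition consistent :: "real \<Rightarrow> real \<Rightarrow> (nat \<times> real) list \<Rightarrow> bool" where
  "consistent lo hi us \<longleftrightarrow> (\<forall>(p, x)\<in>set us. lo < x \<and> x < hi) \<and>
     (\<forall>(p, x)\<in>set us. \<forall>(q, y)\<in>set us. p < q \<longrightarrow> x < y)"

text \<open>The recursion splits the interval at the value of the earliest entry and distributes everything
else to the two sides, until no embedded entry is left inside; the intervals that remain are the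
gaps of the state.\<close>

fun potential :: "real \<Rightarrow> real \<Rightarrow> (nat \<times> real) list \<Rightarrow> nat list \<Rightarrow> real" where
  "potential lo hi [] ws = pattern_cost ws / (hi - lo)"
| "potential lo hi ((p, x) # us) ws =
     potential lo x (filter (\<lambda>u. fst u < p) us) (filter (\<lambda>q. q < p) ws) +
     potential x hi (filter (\<lambda>u. p < fst u) us) (filter (\<lambda>q. p < q) ws)"

lemma consistent_filter:
  assumes "consistent lo hi ((p, x) # us)"
  shows "consistent lo x (filter (\<lambda>u. fst u < p) us)" "consistent x hi (filter (\<lambda>u. p < fst u) us)"
    "lo < x" "x < hi"
  using assms by (auto simp: consistent_def split: prod.splits)

lemma potential_nonneg: "consistent lo hi us \<Longrightarrow> lo < hi \<Longrightarrow> 0 \<le> potential lo hi us ws"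
  by (induction lo hi us ws rule: potential.induct)
     (auto dest: consistent_filter intro!: add_nonneg_nonneg simp: pattern_cost_nonneg)

lemma potential_Nil: "potential lo hi us [] = 0"
proof (induction us arbitrary: lo hi rule: length_induct)
  case (1 us)
  show ?case
  proof (cases us)
    case (Cons u us')
    thus ?thesis using 1 by (cases u) (auto simp: less_Suc_eq_le)
  qed simp
qed

text \<open>The next two lemmas locate a new entry: when it lies below (above) \<open>p\<close>, its constraints against
the entries on the other side of \<open>p\<close> follow from its position relative to the value of \<open>p\<close>.\<close>

lemma consistent_append_left:
  assumes "consistent lo hi ((p, x) # us)" "p \<notin> fst ` set us" "q < p"
  shows "consistent lo hi (((p, x) # us) @ [(q, y)]) \<longleftrightarrow>
           consistent lo x (filter (\<lambda>u. fst u < p) us @ [(q, y)])"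
proof
  assume "consistent lo hi (((p, x) # us) @ [(q, y)])"
  thus "consistent lo x (filter (\<lambda>u. fst u < p) us @ [(q, y)])"
    using assms(3) unfolding consistent_def by fastforce
next
  assume a: "consistent lo x (filter (\<lambda>u. fst u < p) us @ [(q, y)])"
  hence y: "lo < y" "y < x" by (auto simp: consistent_def)
  have l: "(p' < q \<longrightarrow> x' < y) \<and> (q < p' \<longrightarrow> y < x')" if "(p', x') \<in> set us" for p' x'
  proof (cases "p' < p")
    case True thus ?thesis using a that by (auto simp: consistent_def)
  next
    case False
    hence "p < p'" using that assms(2) by force
    thus ?thesis using assms that y by (fastforce simp: consistent_def)
  qed
  show "consistent lo hi (((p, x) # us) @ [(q, y)])"
    using assms(1,3) y l unfolding consistent_def by fastforce
qed

lemma consistent_append_right: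
  assumes "consistent lo hi ((p, x) # us)" "p \<notin> fst ` set us" "p < q"
  shows "consistent lo hi (((p, x) # us) @ [(q, y)]) \<longleftrightarrow>
           consistent x hi (filter (\<lambda>u. p < fst u) us @ [(q, y)])"
proof
  assume "consistent lo hi (((p, x) # us) @ [(q, y)])"
  thus "consistent x hi (filter (\<lambda>u. p < fst u) us @ [(q, y)])"
    using assms(3) unfolding consistent_def by fastforce
next
  assume a: "consistent x hi (filter (\<lambda>u. p < fst u) us @ [(q, y)])"
  hence y: "x < y" "y < hi" by (auto simp: consistent_def)
  have l: "(p' < q \<longrightarrow> x' < y) \<and> (q < p' \<longrightarrow> y < x')" if "(p', x') \<in> set us" for p' x'
  proof (cases "p < p'")
    case True thus ?thesis using a that by (auto simp: consistent_def)
  next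
    case False
    hence "p' < p" using that assms(2) by force
    thus ?thesis using assms that y by (fastforce simp: consistent_def)
  qed
  show "consistent lo hi (((p, x) # us) @ [(q, y)])"
    using assms(1,3) y l unfolding consistent_def by fastforce
qed

text \<open>Embedding one more entry \<open>q\<close> affects only its own gap \<open>(a, b)\<close>, whose pattern is \<open>q # \<sigma>\<close>: the
contribution \<open>C\<close> of the other gaps is unchanged, and the admissible values for \<open>q\<close> are exactly
those in the gap. The induction descends to the side of the earliest entry on which \<open>q\<close> lies and
adds the other side to \<open>C\<close>.\<close>

lemma potential_gap:
  assumes "lo < hi" "consistent lo hi us" "distinct (map fst us)" "q \<notin> fst ` set us"
  shows "\<exists>C a b \<sigma>. lo \<le> a \<and> a < b \<and> b \<le> hi \<and>
    potential lo hi us (q # ws) = C + pattern_cost (q # \<sigma>) / (b - a) \<and>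
    (\<forall>y. consistent lo hi (us @ [(q, y)]) \<longleftrightarrow> a < y \<and> y < b) \<and>
    (\<forall>y. potential lo hi (us @ [(q, y)]) ws =
      C + (pattern_cost (filter (\<lambda>p. p < q) \<sigma>) / (y - a) + pattern_cost (filter (\<lambda>p. q < p) \<sigma>) / (b - y)))"
  using assms
proof (induction lo hi us ws rule: potential.induct)
  case (1 lo hi ws)
  have "consistent lo hi ([] @ [(q, y)]) \<longleftrightarrow> lo < y \<and> y < hi" for y
    by (simp add: consistent_def)
  thus ?case using 1 by (intro exI[of _ 0] exI[of _ lo] exI[of _ hi] exI[of _ ws]) simp
next
  case (2 lo hi p x us ws)
  note c = consistent_filter[OF 2(4)]
  have p: "p \<notin> fst ` set us" "q \<noteq> p" using 2(5,6) by force+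
  have d: "distinct (map fst (filter P us))" "q \<notin> fst ` set (filter P us)" for P
    using 2(5,6) by (auto simp: distinct_map_filter)
  show ?case
  proof (cases "q < p")
    case True
    note cl = consistent_append_left[OF 2(4) p(1) True]
    from 2(1)[OF c(3,1) d] obtain C a b \<sigma> where IH: "lo \<le> a" "a < b" "b \<le> x"
      "potential lo x (filter (\<lambda>u. fst u < p) us) (q # filter (\<lambda>q. q < p) ws) = C + pattern_cost (q # \<sigma>) / (b - a)"
      "\<And>y. consistent lo x (filter (\<lambda>u. fst u < p) us @ [(q, y)]) \<longleftrightarrow> a < y \<and> y < b"
      "\<And>y. potential lo x (filter (\<lambda>u. fst u < p) us @ [(q, y)]) (filter (\<lambda>q. q < p) ws) =
        C + (pattern_cost (filter (\<lambda>p. p < q) \<sigma>) / (y - a) + pattern_cost (filter (\<lambda>p. q < p) \<sigma>) / (b - y))"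
      by metis
    show ?thesis
      by (rule exI[of _ "C + potential x hi (filter (\<lambda>u. p < fst u) us) (filter (\<lambda>q. p < q) ws)"],
          rule exI[of _ a], rule exI[of _ b], rule exI[of _ \<sigma>])
         (use IH True c(4) cl in \<open>simp del: pattern_cost.simps add: algebra_simps\<close>)
  next
    case False
    hence pq: "p < q" using p(2) by simp
    note cr = consistent_append_right[OF 2(4) p(1) pq]
    from 2(2)[OF c(4,2) d] obtain C a b \<sigma> where IH: "x \<le> a" "a < b" "b \<le> hi"
      "potential x hi (filter (\<lambda>u. p < fst u) us) (q # filter (\<lambda>q. p < q) ws) = C + pattern_cost (q # \<sigma>) / (b - a)"
      "\<And>y. consistent x hi (filter (\<lambda>u. p < fst u) us @ [(q, y)]) \<longleftrightarrow> a < y \<and> y < b"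
      "\<And>y. potential x hi (filter (\<lambda>u. p < fst u) us @ [(q, y)]) (filter (\<lambda>q. p < q) ws) =
        C + (pattern_cost (filter (\<lambda>p. p < q) \<sigma>) / (y - a) + pattern_cost (filter (\<lambda>p. q < p) \<sigma>) / (b - y))"
      by metis
    show ?thesis
      by (rule exI[of _ "C + potential lo x (filter (\<lambda>u. fst u < p) us) (filter (\<lambda>q. q < p) ws)"],
          rule exI[of _ a], rule exI[of _ b], rule exI[of _ \<sigma>])
         (use IH pq c(3) cr in \<open>simp del: pattern_cost.simps add: algebra_simps\<close>)
  qed
qed

text \<open>A gap of length \<open>h\<close> is hit with probability \<open>h\<close>, and the improvement there is scaled by \<open>1 / h\<close>;
the two factors cancel.\<close>

lemma stop_level_scaled:
  assumes "0 \<le> l" "0 \<le> r" "a < b"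
  shows "(\<integral>\<^sup>+y\<in>{a<..<b}. ennreal (stop_level l r / (b - a) - (l / (y - a) + r / (b - y))) \<partial>lborel) = 1"
proof -
  let ?h = "b - a"
  define f where "f y = ennreal (stop_level l r / ?h - (l / (y - a) + r / (b - y))) * indicator {a<..<b} y" for y
  have [measurable]: "f \<in> borel_measurable borel" unfolding f_def by measurable
  have "ennreal ?h * f (a + ?h * z) = ennreal (stop_level l r - split_cost l r z) * indicator {0<..<1} z" for z
  proof -
    have "b - (a + ?h * z) = ?h * (1 - z)" by (simp add: algebra_simps)
    moreover have "a < a + ?h * z \<longleftrightarrow> 0 < z" using assms(3) by (simp add: zero_less_mult_iff)
    moreover have "a + ?h * z < b \<longleftrightarrow> z < 1"
      using assms(3) calculation(1) by (metis diff_gt_0_iff_gt zero_less_mult_pos zero_less_mult_iff)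
    moreover have "?h * (stop_level l r / ?h - (l / (?h * z) + r / (?h * (1 - z)))) = stop_level l r - split_cost l r z"
    proof -
      have "?h * (l / (?h * z)) = l / z" "?h * (r / (?h * (1 - z))) = r / (1 - z)"
        using assms(3) by (metis diff_gt_0_iff_gt less_irrefl mult_divide_mult_cancel_left times_divide_eq_right)+
      thus ?thesis
        using assms(3) unfolding split_cost_def right_diff_distrib[of ?h "stop_level l r / ?h"] distrib_left by simp
    qed
    ultimately show ?thesis
      using assms(3) by (simp add: f_def indicator_def ennreal_mult'[symmetric])
  qed
  hence "(\<integral>\<^sup>+z. ennreal ?h * f (a + ?h * z) \<partial>lborel) = 1"
    using stop_level_eq[OF assms(1,2)] by simp
  hence "(\<integral>\<^sup>+y. f y \<partial>lborel) = 1"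
    using assms(3) by (subst nn_integral_real_affine[where c = ?h and t = a]) (auto simp: nn_integral_cmult)
  thus ?thesis by (simp add: f_def)
qed

text \<open>The Bellman equation: in every state, a uniform sample offers a potential drop whose positive
part has expectation 1, the cost of looking at it.\<close>

lemma potential_drop_integral:
  assumes "consistent 0 1 us" "distinct (map fst us)" "q \<notin> fst ` set us"
  shows "(\<integral>\<^sup>+y\<in>{0..1}. ennreal (if consistent 0 1 (us @ [(q, y)])
            then potential 0 1 us (q # ws) - potential 0 1 (us @ [(q, y)]) ws else 0) \<partial>lborel) = 1"
proof -
  obtain C a b \<sigma> where *: "0 \<le> a" "a < b" "b \<le> 1"
    "potential 0 1 us (q # ws) = C + pattern_cost (q # \<sigma>) / (b - a)"
    "\<And>y. consistent 0 1 (us @ [(q, y)]) \<longleftrightarrow> a < y \<and> y < b"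
    "\<And>y. potential 0 1 (us @ [(q, y)]) ws =
      C + (pattern_cost (filter (\<lambda>p. p < q) \<sigma>) / (y - a) + pattern_cost (filter (\<lambda>p. q < p) \<sigma>) / (b - y))"
    using potential_gap[OF _ assms, of ws] by auto
  have "(\<integral>\<^sup>+y\<in>{0..1}. ennreal (if consistent 0 1 (us @ [(q, y)])
            then potential 0 1 us (q # ws) - potential 0 1 (us @ [(q, y)]) ws else 0) \<partial>lborel) =
    (\<integral>\<^sup>+y\<in>{a<..<b}. ennreal (pattern_cost (q # \<sigma>) / (b - a) -
        (pattern_cost (filter (\<lambda>p. p < q) \<sigma>) / (y - a) + pattern_cost (filter (\<lambda>p. q < p) \<sigma>) / (b - y))) \<partial>lborel)"
    unfolding *(4-6) using *(1,3) by (intro nn_integral_cong) (auto simp: indicator_def)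
  also have "\<dots> = 1"
    using stop_level_scaled[OF pattern_cost_nonneg pattern_cost_nonneg *(2)] by simp
  finally show ?thesis .
qed

section \<open>States of an embedding process\<close>

text \<open>A state is recorded by the number \<open>j\<close> of embedded entries and the sequence \<open>x\<close> of their values;
only the values \<open>x i\<close> with \<open>i < j\<close> matter. In this form measurability reduces to that of real
functions for each of countably many \<open>j\<close>.\<close>

definition placed :: "nat list \<Rightarrow> nat \<Rightarrow> (nat \<Rightarrow> real) \<Rightarrow> (nat \<times> real) list" where
  "placed \<pi> j x = map (\<lambda>i. (\<pi> ! i, x i)) [0..<j]"

definition state_potential :: "nat list \<Rightarrow> nat \<Rightarrow> (nat \<Rightarrow> real) \<Rightarrow> real" where
  "state_potential \<pi> j x = potential 0 1 (placed \<pi> j x) (drop j \<pi>)"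

text \<open>The potential drop from embedding the next entry at \<open>y\<close>, possibly negative. A sample that
cannot be used counts as no drop.\<close>

definition gain :: "nat list \<Rightarrow> nat \<Rightarrow> (nat \<Rightarrow> real) \<Rightarrow> real \<Rightarrow> real" where
  "gain \<pi> j x y =
     (if j < length \<pi> \<and> consistent 0 1 (placed \<pi> (Suc j) (x(j := y)))
      then state_potential \<pi> j x - state_potential \<pi> (Suc j) (x(j := y)) else 0)"

lemma placed_0 [simp]: "placed \<pi> 0 x = []"
  by (simp add: placed_def)

lemma placed_cong: "(\<And>i. i < j \<Longrightarrow> x i = y i) \<Longrightarrow> placed \<pi> j x = placed \<pi> j y"
  by (simp add: placed_def)

lemma placed_Suc: "placed \<pi> (Suc j) (x(j := y)) = placed \<pi> j x @ [(\<pi> ! j, y)]"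
  by (simp add: placed_def)

lemma consistent_placed:
  "consistent 0 1 (placed \<pi> j x) \<longleftrightarrow>
     (\<forall>i\<in>{..<j}. 0 < x i \<and> x i < 1) \<and> (\<forall>i\<in>{..<j}. \<forall>i'\<in>{..<j}. \<pi> ! i < \<pi> ! i' \<longrightarrow> x i < x i')"
  by (fastforce simp: consistent_def placed_def)

lemma gain_integral:
  assumes "distinct \<pi>" "j < length \<pi>" "consistent 0 1 (placed \<pi> j x)"
  shows "(\<integral>\<^sup>+y\<in>{0..1}. ennreal (gain \<pi> j x y) \<partial>lborel) = 1"
proof -
  have "map fst (placed \<pi> j x) = take j \<pi>"
    using assms(2) by (simp add: placed_def o_def list_eq_iff_nth_eq)
  hence d: "distinct (map fst (placed \<pi> j x))" by (simp add: assms(1))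
  have "\<pi> ! j \<notin> fst ` set (placed \<pi> j x)"
    using assms(1,2) by (auto simp: placed_def nth_eq_iff_index_eq)
  from potential_drop_integral[OF assms(3) d this, of "drop (Suc j) \<pi>"] show ?thesis
    using assms(2) by (simp add: gain_def state_potential_def placed_Suc Cons_nth_drop_Suc if_distrib cong: if_cong)
qed

lemma measurable_potential:
  assumes "\<And>u. u \<in> set us \<Longrightarrow> snd u \<in> borel_measurable N" "lo \<in> borel_measurable N" "hi \<in> borel_measurable N"
  shows "(\<lambda>\<omega>. potential (lo \<omega>) (hi \<omega>) (map (\<lambda>u. (fst u, snd u \<omega>)) us) ws) \<in> borel_measurable N"
  using assms
proof (induction us arbitrary: lo hi ws rule: length_induct)
  case (1 us)
  show ?case
  proof (cases us)
    case Nil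
    note [measurable] = 1(3,4)
    show ?thesis unfolding Nil by simp
  next
    case (Cons u us')
    note m = 1(3,4) 1(2)[of u]
    have *: "(\<lambda>\<omega>. potential (a \<omega>) (b \<omega>) (map (\<lambda>u. (fst u, snd u \<omega>)) (filter P us')) vs) \<in> borel_measurable N"
      if "a \<in> borel_measurable N" "b \<in> borel_measurable N" for P a b vs
      by (rule 1(1)[rule_format]) (use 1(2) that Cons in \<open>auto simp: less_Suc_eq_le\<close>)
    have f: "filter (\<lambda>v. fst v < p) (map (\<lambda>u. (fst u, snd u \<omega>)) us') =
        map (\<lambda>u. (fst u, snd u \<omega>)) (filter (\<lambda>v. fst v < p) us')"
      "filter (\<lambda>v. p < fst v) (map (\<lambda>u. (fst u, snd u \<omega>)) us') =
        map (\<lambda>u. (fst u, snd u \<omega>)) (filter (\<lambda>v. p < fst v) us')" for \<omega> p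
      by (simp_all add: filter_map o_def)
    show ?thesis unfolding Cons list.map potential.simps f
      by (intro borel_measurable_add *) (use m Cons in auto)
  qed
qed

lemma measurable_gain:
  assumes [measurable]: "\<And>i. (\<lambda>\<omega>. x \<omega> i) \<in> borel_measurable N" "y \<in> borel_measurable N"
  shows "(\<lambda>\<omega>. gain \<pi> j (x \<omega>) (y \<omega>)) \<in> borel_measurable N"
proof -
  have sp: "(\<lambda>\<omega>. state_potential \<pi> j (z \<omega>)) \<in> borel_measurable N"
    if "\<And>i. (\<lambda>\<omega>. z \<omega> i) \<in> borel_measurable N" for z j
  proof -
    have "(\<lambda>\<omega>. potential 0 1 (map (\<lambda>u. (fst u, snd u \<omega>)) (map (\<lambda>i. (\<pi> ! i, \<lambda>\<omega>. z \<omega> i)) [0..<j])) (drop j \<pi>))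
        \<in> borel_measurable N"
      by (rule measurable_potential) (use that in auto)
    thus ?thesis by (simp add: state_potential_def placed_def o_def)
  qed
  have z [measurable]: "(\<lambda>\<omega>. ((x \<omega>)(j := y \<omega>)) i) \<in> borel_measurable N" for i
    by (cases "i = j") auto
  note [measurable] = sp[of x j] sp[of "\<lambda>\<omega>. (x \<omega>)(j := y \<omega>)" "Suc j"]
  show ?thesis unfolding gain_def consistent_placed by measurable
qed

section \<open>Independence of the next sample\<close>

locale uniform_stream = prob_space M for M :: "'a measure" +
  fixes X :: "nat \<Rightarrow> 'a \<Rightarrow> real"
  assumes indep: "indep_vars (\<lambda>_. borel) X {1..}"
    and uniform: "1 \<le> i \<Longrightarrow> distr M borel (X i) = uniform_measure lborel {0..1}"
begin

abbreviation "F t \<equiv> natural_filtration M X (enat t)"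

lemma X_measurable: "1 \<le> i \<Longrightarrow> random_variable borel (X i)"
  using indep by (auto simp: indep_vars_def)

lemma generators_le: "{X i -` B \<inter> space M | i B. 1 \<le> i \<and> enat i \<le> t \<and> B \<in> sets borel} \<subseteq> sets M"
  using X_measurable by (auto intro: measurable_sets)

lemma space_filtration [simp]: "space (natural_filtration M X t) = space M"
  unfolding natural_filtration_def by (rule space_measure_of) auto

lemma sets_filtration:
  "sets (natural_filtration M X t) =
     sigma_sets (space M) {X i -` B \<inter> space M | i B. 1 \<le> i \<and> enat i \<le> t \<and> B \<in> sets borel}"
  unfolding natural_filtration_def by (rule sets_measure_of) auto

lemma id_measurable_filtration: "(\<lambda>\<omega>. \<omega>) \<in> measurable M (natural_filtration M X t)"
proof (rule measurableI)
  fix A assume "A \<in> sets (natural_filtration M X t)"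
  thus "(\<lambda>\<omega>. \<omega>) -` A \<inter> space M \<in> sets M"
    using sets.sigma_sets_subset[OF generators_le, of t] sets.sets_into_space[of A "natural_filtration M X t"]
    by (auto simp: sets_filtration Int_absorb2)
qed simp

lemma measurable_filtration_mono:
  "s \<le> t \<Longrightarrow> f \<in> measurable (natural_filtration M X s) N \<Longrightarrow> f \<in> measurable (natural_filtration M X t) N"
proof -
  assume "s \<le> t" and f: "f \<in> measurable (natural_filtration M X s) N"
  hence "sets (natural_filtration M X s) \<subseteq> sets (natural_filtration M X t)"
    unfolding sets_filtration by (intro sigma_sets_mono') (auto intro: order_trans)
  thus "f \<in> measurable (natural_filtration M X t) N"
    using f by (auto simp: measurable_def)
qed

lemma measurable_filtrationD: "f \<in> measurable (natural_filtration M X t) N \<Longrightarrow> f \<in> measurable M N"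
  by (rule measurable_compose[OF id_measurable_filtration])

lemma X_measurable_filtration:
  assumes "1 \<le> i" "i \<le> t"
  shows "X i \<in> borel_measurable (F t)"
  using assms by (intro measurableI) (auto simp: sets_filtration)

lemma AE_X: "AE \<omega> in M. \<forall>i\<ge>1. 0 < X i \<omega> \<and> X i \<omega> < 1"
  unfolding AE_all_countable
proof
  fix i
  show "AE \<omega> in M. 1 \<le> i \<longrightarrow> 0 < X i \<omega> \<and> X i \<omega> < 1"
  proof (cases "1 \<le> i")
    case True
    have "AE y in uniform_measure lborel {0..1::real}. 0 < y \<and> y < 1"
      using AE_lborel_singleton[of 0] AE_lborel_singleton[of "1::real"]
      by (intro AE_uniform_measureI) (auto elim!: eventually_elim2)
    hence "AE y in distr M borel (X i). 0 < y \<and> y < 1" unfolding uniform[OF True] .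
    thus ?thesis by (subst (asm) AE_distr_iff) (use X_measurable[OF True] in auto)
  qed simp
qed

text \<open>The \<open>\<sigma>\<close>-algebra \<open>F t\<close> is generated by the first \<open>t\<close> coordinates, a block disjoint from the
next one.\<close>

lemma indep_next:
  "indep_set (sets (F t)) (sigma_sets (space M) {X (Suc t) -` A \<inter> space M |A. A \<in> sets borel})"
proof -
  let ?E = "\<lambda>i. {X i -` A \<inter> space M |A. A \<in> sets borel}"
  have 1: "indep_sets ?E (\<Union>b\<in>UNIV. case_bool {1..t} {Suc t} b)"
    by (rule indep_sets_mono_index[of _ "{1..}"])
       (use indep in \<open>auto simp: indep_vars_def2 split: bool.splits\<close>)
  have 2: "indep_sets (\<lambda>b. sigma_sets (space M) (\<Union>i\<in>case_bool {1..t} {Suc t} b. ?E i)) UNIV"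
  proof (rule indep_sets_collect_sigma[OF 1])
    show "Int_stable (?E i)" for i
      by (auto simp: Int_stable_def) (metis sets.Int vimage_Int Int_assoc Int_left_commute Int_absorb)
  qed (auto simp: disjoint_family_on_def split: bool.splits)
  have 3: "(\<Union>i\<in>{1..t}. ?E i) = {X i -` B \<inter> space M | i B. 1 \<le> i \<and> enat i \<le> enat t \<and> B \<in> sets borel}"
    by (simp only: set_eq_iff UN_iff Bex_def mem_Collect_eq atLeastAtMost_iff enat_ord_simps) blast
  show ?thesis
    unfolding indep_set_def
    by (rule indep_sets_cong[THEN iffD1, OF refl _ 2])
       (auto simp: 3[unfolded One_nat_def] sets_filtration split: bool.splits)
qed

text \<open>Integrating out the next sample. Independence is applied to the identity map from the sample
space into \<open>F t\<close> and the next sample, which gives a product measure on pairs \<open>(\<omega>, y)\<close> in which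
\<open>F t\<close>-measurable quantities keep their form.\<close>

lemma nn_integral_next:
  assumes [measurable]: "f \<in> borel_measurable (F t \<Otimes>\<^sub>M borel)"
  shows "(\<integral>\<^sup>+\<omega>. f (\<omega>, X (Suc t) \<omega>) \<partial>M) = (\<integral>\<^sup>+\<omega>. (\<integral>\<^sup>+y\<in>{0..1}. f (\<omega>, y) \<partial>lborel) \<partial>M)"
proof -
  note [measurable] = id_measurable_filtration[of "enat t"] X_measurable
  have Xm [measurable]: "random_variable borel (X (Suc t))" by (rule X_measurable) simp
  interpret D: prob_space "distr M (F t) (\<lambda>\<omega>. \<omega>)" by (rule prob_space_distr) measurable
  interpret U: prob_space "distr M borel (X (Suc t))" by (rule prob_space_distr) measurable
  interpret P: pair_prob_space "distr M (F t) (\<lambda>\<omega>. \<omega>)" "distr M borel (X (Suc t))" ..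
  have pair: "distr M (F t) (\<lambda>\<omega>. \<omega>) \<Otimes>\<^sub>M distr M borel (X (Suc t)) =
      distr M (F t \<Otimes>\<^sub>M borel) (\<lambda>\<omega>. (\<omega>, X (Suc t) \<omega>))"
  proof (rule pair_measure_eqI)
    fix A B assume A: "A \<in> sets (distr M (F t) (\<lambda>\<omega>. \<omega>))" and B: "B \<in> sets (distr M borel (X (Suc t)))"
    have A': "(\<lambda>\<omega>. \<omega>) -` A \<inter> space M = A"
      using A sets.sets_into_space[of A "F t"] by auto
    have "prob (A \<inter> (X (Suc t) -` B \<inter> space M)) = prob A * prob (X (Suc t) -` B \<inter> space M)"
      by (rule indep_setD[OF indep_next[of t]]) (use A B in auto)
    moreover have "(\<lambda>\<omega>. (\<omega>, X (Suc t) \<omega>)) -` (A \<times> B) \<inter> space M = A \<inter> (X (Suc t) -` B \<inter> space M)"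
      using A' by auto
    moreover have "A \<inter> space M = A" using A' by auto
    ultimately show "emeasure (distr M (F t) (\<lambda>\<omega>. \<omega>)) A * emeasure (distr M borel (X (Suc t))) B =
        emeasure (distr M (F t \<Otimes>\<^sub>M borel) (\<lambda>\<omega>. (\<omega>, X (Suc t) \<omega>))) (A \<times> B)"
      using A B by (simp add: emeasure_distr A' emeasure_eq_measure ennreal_mult)
  qed (auto intro!: sets_pair_measure_cong D.sigma_finite_measure_axioms U.sigma_finite_measure_axioms)
  have "(\<integral>\<^sup>+\<omega>. f (\<omega>, X (Suc t) \<omega>) \<partial>M) = (\<integral>\<^sup>+z. f z \<partial>distr M (F t \<Otimes>\<^sub>M borel) (\<lambda>\<omega>. (\<omega>, X (Suc t) \<omega>)))"
    by (subst nn_integral_distr) auto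
  also have "\<dots> = (\<integral>\<^sup>+z. f z \<partial>(distr M (F t) (\<lambda>\<omega>. \<omega>) \<Otimes>\<^sub>M distr M borel (X (Suc t))))"
    by (simp only: pair)
  also have "\<dots> = (\<integral>\<^sup>+\<omega>. (\<integral>\<^sup>+y. f (\<omega>, y) \<partial>distr M borel (X (Suc t))) \<partial>distr M (F t) (\<lambda>\<omega>. \<omega>))"
    by (rule U.nn_integral_fst[symmetric]) measurable
  also have "\<dots> = (\<integral>\<^sup>+\<omega>. (\<integral>\<^sup>+y. f (\<omega>, y) \<partial>distr M borel (X (Suc t))) \<partial>M)"
    by (subst nn_integral_distr) auto
  also have "\<dots> = (\<integral>\<^sup>+\<omega>. (\<integral>\<^sup>+y\<in>{0..1}. f (\<omega>, y) \<partial>lborel) \<partial>M)"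
  proof (rule nn_integral_cong)
    fix \<omega> assume "\<omega> \<in> space M"
    hence "(\<lambda>y. f (\<omega>, y)) \<in> borel_measurable borel" by measurable
    thus "(\<integral>\<^sup>+y. f (\<omega>, y) \<partial>distr M borel (X (Suc t))) = (\<integral>\<^sup>+y\<in>{0..1}. f (\<omega>, y) \<partial>lborel)"
      by (subst uniform) (auto simp: nn_integral_uniform_measure divide_ennreal_def)
  qed
  finally show ?thesis .
qed

text \<open>For any adapted state \<open>(N, Y)\<close>, the positive part of the gain offered by the next sample has
conditional expectation 1 as long as the pattern is incomplete. Summed over \<open>t\<close>, the right-hand
sides give the expected duration.\<close>

lemma expected_gain:
  assumes "distinct \<pi>"
    and N: "N \<in> measurable (F t) (count_space UNIV)"
    and Y: "\<And>i. (\<lambda>\<omega>. Y \<omega> i) \<in> borel_measurable (F t)"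
    and c: "AE \<omega> in M. N \<omega> < length \<pi> \<longrightarrow> consistent 0 1 (placed \<pi> (N \<omega>) (Y \<omega>))"
  shows "(\<integral>\<^sup>+\<omega>. ennreal (gain \<pi> (N \<omega>) (Y \<omega>) (X (Suc t) \<omega>)) \<partial>M) =
           emeasure M {\<omega> \<in> space M. N \<omega> < length \<pi>}"
proof -
  note [measurable] = N Y
  have g: "(\<lambda>z. gain \<pi> j (Y (fst z)) (snd z)) \<in> borel_measurable (F t \<Otimes>\<^sub>M borel)" for j
    by (rule measurable_gain) measurable
  have [measurable]: "(\<lambda>z. gain \<pi> (N (fst z)) (Y (fst z)) (snd z)) \<in> borel_measurable (F t \<Otimes>\<^sub>M borel)"
    by (rule measurable_compose_countable[where f = "\<lambda>j z. gain \<pi> j (Y (fst z)) (snd z)", OF g]) measurable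
  have [measurable]: "N \<in> measurable M (count_space UNIV)"
    by (rule measurable_filtrationD[OF N])
  have "(\<integral>\<^sup>+\<omega>. ennreal (gain \<pi> (N \<omega>) (Y \<omega>) (X (Suc t) \<omega>)) \<partial>M) =
      (\<integral>\<^sup>+\<omega>. (\<integral>\<^sup>+y\<in>{0..1}. ennreal (gain \<pi> (N \<omega>) (Y \<omega>) y) \<partial>lborel) \<partial>M)"
    using nn_integral_next[of "\<lambda>z. ennreal (gain \<pi> (N (fst z)) (Y (fst z)) (snd z))" t] by simp
  also have "\<dots> = (\<integral>\<^sup>+\<omega>. indicator {\<omega> \<in> space M. N \<omega> < length \<pi>} \<omega> \<partial>M)"
  proof (rule nn_integral_cong_AE)
    show "AE \<omega> in M. (\<integral>\<^sup>+y\<in>{0..1}. ennreal (gain \<pi> (N \<omega>) (Y \<omega>) y) \<partial>lborel) =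
        indicator {\<omega> \<in> space M. N \<omega> < length \<pi>} \<omega>"
      using c AE_space
    proof eventually_elim
      case (elim \<omega>)
      show ?case
      proof (cases "N \<omega> < length \<pi>")
        case True thus ?thesis using elim gain_integral[OF assms(1) True] by simp
      next
        case False
        hence "gain \<pi> (N \<omega>) (Y \<omega>) y = 0" for y by (simp add: gain_def)
        thus ?thesis using False by simp
      qed
    qed
  qed
  also have "\<dots> = emeasure M {\<omega> \<in> space M. N \<omega> < length \<pi>}" by simp
  finally show ?thesis .
qed

end

section \<open>Lower bound for every online algorithm\<close>

lemma state_potential_0 [simp]: "state_potential \<pi> 0 x = pattern_cost \<pi>"
  by (simp add: state_potential_def)

lemma state_potential_length [simp]: "state_potential \<pi> (length \<pi>) x = 0"
  by (simp add: state_potential_def potential_Nil)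

lemma gain_cong:
  assumes "\<And>i. i < j \<Longrightarrow> x i = x' i"
  shows "gain \<pi> j x y = gain \<pi> j x' y"
  using placed_cong[of j x x' \<pi>] assms by (simp add: gain_def state_potential_def placed_Suc)

text \<open>Telescoping: the potential starts at the cost of the pattern and ends at 0.\<close>

lemma pattern_cost_le_sum_gains:
  assumes "consistent 0 1 (placed \<pi> (length \<pi>) x)"
  shows "ennreal (pattern_cost \<pi>) \<le> (\<Sum>i<length \<pi>. ennreal (gain \<pi> i x (x i)))"
proof -
  have "ennreal (pattern_cost \<pi>) \<le> ennreal (state_potential \<pi> n x) + (\<Sum>i<n. ennreal (gain \<pi> i x (x i)))"
    if "n \<le> length \<pi>" for n
    using that
  proof (induction n)
    case (Suc n)
    have "consistent 0 1 (placed \<pi> (Suc n) x)"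
      using assms Suc.prems by (auto simp: consistent_placed)
    hence "state_potential \<pi> n x = state_potential \<pi> (Suc n) x + gain \<pi> n x (x n)"
      using Suc.prems by (simp add: gain_def)
    hence "ennreal (state_potential \<pi> n x) \<le> ennreal (state_potential \<pi> (Suc n) x) + ennreal (gain \<pi> n x (x n))"
      by (simp add: ennreal_plus_if ennreal_leI)
    hence "ennreal (state_potential \<pi> n x) + (\<Sum>i<n. ennreal (gain \<pi> i x (x i))) \<le>
        ennreal (state_potential \<pi> (Suc n) x) + (\<Sum>i<Suc n. ennreal (gain \<pi> i x (x i)))"
      by (simp add: add.assoc add.commute add_left_mono add.left_commute)
    with Suc show ?case by (meson Suc_leD order_trans)
  qed simp
  from this[of "length \<pi>"] show ?thesis by simp
qed

lemma downclosed_eq_lessThan_card: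
  fixes A :: "nat set"
  assumes "finite A" "\<And>i j. i < j \<Longrightarrow> j \<in> A \<Longrightarrow> i \<in> A"
  shows "A = {..<card A}"
proof -
  define n where "n = (LEAST n. n \<notin> A)"
  have n: "n \<notin> A" unfolding n_def
    by (rule LeastI_ex) (rule ex_new_if_finite[OF infinite_UNIV_nat assms(1)])
  have "i \<in> A" if "i < n" for i using not_less_Least[of i] that by (auto simp: n_def)
  moreover have "i < n" if "i \<in> A" for i
    using n assms(2)[of n i] that by (cases i n rule: linorder_cases) auto
  ultimately have "A = {..<n}" by blast
  thus ?thesis by simp
qed

context uniform_stream
begin

lemma stopping_time_le:
  assumes "stopping_time (natural_filtration M X) \<tau>" "s \<le> t"
  shows "Measurable.pred (F t) (\<lambda>\<omega>. \<tau> \<omega> \<le> enat s)"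
  using assms(1) measurable_filtration_mono[of "enat s" "enat t"] assms(2)
  by (auto simp: stopping_time_def)

lemma stopping_time_eq:
  assumes "stopping_time (natural_filtration M X) \<tau>" "Suc s \<le> t"
  shows "Measurable.pred (F t) (\<lambda>\<omega>. \<tau> \<omega> = enat (Suc s))"
proof -
  have [measurable]: "Measurable.pred (F t) (\<lambda>\<omega>. \<tau> \<omega> \<le> enat (Suc s))" "Measurable.pred (F t) (\<lambda>\<omega>. \<tau> \<omega> \<le> enat s)"
    using assms by (auto intro: stopping_time_le)
  have "\<tau> \<omega> = enat (Suc s) \<longleftrightarrow> \<tau> \<omega> \<le> enat (Suc s) \<and> \<not> \<tau> \<omega> \<le> enat s" for \<omega>
    by (cases "\<tau> \<omega>") auto
  thus ?thesis by simp
qed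

lemma
  assumes "stopping_time (natural_filtration M X) \<tau>"
  shows expectation_stopping_time: "(\<integral>\<^sup>+\<omega>. ennreal_of_enat (\<tau> \<omega>) \<partial>M) = (\<Sum>t. emeasure M {\<omega> \<in> space M. enat t < \<tau> \<omega>})"
    and measurable_stopping_time: "\<tau> \<in> measurable M (count_space UNIV)"
proof -
  have [measurable]: "Measurable.pred M (\<lambda>\<omega>. \<tau> \<omega> \<le> enat s)" for s
    by (rule measurable_filtrationD[OF stopping_time_le[OF assms order_refl]])
  have "{\<omega> \<in> space M. \<tau> \<omega> = a} \<in> sets M" for a
  proof (cases a)
    case (enat s)
    have "{\<omega> \<in> space M. \<tau> \<omega> = a} = {\<omega> \<in> space M. \<tau> \<omega> \<le> enat s \<and> (\<forall>r<s. \<not> \<tau> \<omega> \<le> enat r)}"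
      (is "?L = ?R")
    proof (intro equalityI subsetI)
      fix \<omega> assume "\<omega> \<in> ?R" thus "\<omega> \<in> ?L" using enat
        by (cases "\<tau> \<omega>") (auto, meson linorder_neqE_nat less_irrefl not_less)
    qed (use enat in auto)
    thus ?thesis by simp
  next
    case infinity
    have "{\<omega> \<in> space M. \<tau> \<omega> = a} = {\<omega> \<in> space M. \<forall>s. \<not> \<tau> \<omega> \<le> enat s}"
      unfolding infinity by (auto, metis enat.exhaust order_refl)
    thus ?thesis by simp
  qed
  thus "\<tau> \<in> measurable M (count_space UNIV)"
    by (subst measurable_count_space_eq_countable) (auto simp: vimage_def Int_def conj_commute)
  thus "(\<integral>\<^sup>+\<omega>. ennreal_of_enat (\<tau> \<omega>) \<partial>M) = (\<Sum>t. emeasure M {\<omega> \<in> space M. enat t < \<tau> \<omega>})"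
    by (rule nn_integral_enat_function)
qed

text \<open>Counting from 0, the entry \<open>i\<close> is embedded when exactly \<open>i\<close> entries are present.
The drops at the \<open>k\<close> distinct embedding times add up to the cost of the pattern, and they are
among the gains offered up to the last of these times. The positive parts of all these gains have
a total expectation equal to the expected duration.\<close>

lemma pattern_cost_lower:
  assumes \<pi>: "distinct \<pi>" "\<pi> \<noteq> []" and \<tau>s: "\<tau>s \<in> online_algorithms M X \<pi>"
  shows "ennreal (pattern_cost \<pi>) \<le> (\<integral>\<^sup>+\<omega>. ennreal_of_enat (last \<tau>s \<omega>) \<partial>M)"
proof -
  define k where "k = length \<pi>"
  define \<tau> where "\<tau> i = \<tau>s ! i" for i
  have len: "length \<tau>s = k" and k: "0 < k" using \<tau>s \<pi> by (auto simp: online_algorithms_def k_def)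
  have last: "last \<tau>s = \<tau> (k - 1)" using len k by (subst last_conv_nth) (auto simp: \<tau>_def)
  have st: "stopping_time (natural_filtration M X) (\<tau> i)" if "i < k" for i
    using \<tau>s len that by (auto simp: online_algorithms_def \<tau>_def)
  have ge1: "1 \<le> \<tau> i \<omega>" if "i < k" "\<omega> \<in> space M" for i \<omega>
    using \<tau>s len that by (auto simp: online_algorithms_def \<tau>_def)
  have incr: "\<tau> i \<omega> < \<tau> j \<omega> \<or> \<tau> i \<omega> = \<infinity>" if "i < j" "j < k" "\<omega> \<in> space M" for i j \<omega>
  proof -
    have "sorted_wrt (\<lambda>\<sigma> \<tau>. \<sigma> \<omega> < \<tau> \<omega> \<or> \<sigma> \<omega> = \<infinity> \<and> \<tau> \<omega> = \<infinity>) \<tau>s"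
      using \<tau>s that(3) by (simp add: online_algorithms_def)
    from sorted_wrt_nth_less[OF this that(1)] show ?thesis using that(2) len by (auto simp: \<tau>_def)
  qed
  have fin: "AE \<omega> in M. (\<forall>i<k. \<tau> i \<omega> \<noteq> \<infinity>) \<and>
      (\<forall>i<k. \<forall>j<k. X (the_enat (\<tau> i \<omega>)) \<omega> < X (the_enat (\<tau> j \<omega>)) \<omega> \<longleftrightarrow> \<pi> ! i < \<pi> ! j)"
    using \<tau>s unfolding online_algorithms_def
    by (auto simp: order_isomorphic_def len \<tau>_def elim!: eventually_mono)
  \<comment> \<open>The state at time \<open>t\<close>: how many entries are embedded, and at which values.
    Entries that are not yet embedded get the dummy value 0.\<close>
  define N where "N t \<omega> = card {i. i < k \<and> \<tau> i \<omega> \<le> enat t}" for t \<omega>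
  define Y where "Y t \<omega> i = (if i < k \<and> \<tau> i \<omega> \<le> enat t then X (the_enat (\<tau> i \<omega>)) \<omega> else 0)" for t \<omega> i
  have N [measurable]: "N t \<in> measurable (F t) (count_space UNIV)" for t
  proof -
    have "Measurable.pred (F t) (\<lambda>\<omega>. i < k \<and> \<tau> i \<omega> \<le> enat t)" for i
      using stopping_time_le[OF st, of i t t] by (cases "i < k") auto
    hence "{\<omega> \<in> space (F t). i \<in> {i. i < k \<and> \<tau> i \<omega> \<le> enat t}} \<in> sets (F t)" for i
      unfolding pred_def mem_Collect_eq .
    from measurable_card[OF this] show ?thesis unfolding N_def[abs_def] .
  qed
  have Y: "(\<lambda>\<omega>. Y t \<omega> i) \<in> borel_measurable (F t)" for t i
  proof (cases "i < k")
    case True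
    have "(\<lambda>\<omega>. \<Sum>s<t. if \<tau> i \<omega> = enat (Suc s) then X (Suc s) \<omega> else 0) \<in> borel_measurable (F t)"
      by (intro borel_measurable_sum measurable_If X_measurable_filtration borel_measurable_const
            stopping_time_eq[OF st[OF True], unfolded pred_def]) auto
    also have "?this \<longleftrightarrow> ?thesis"
    proof (rule measurable_cong)
      fix \<omega> assume "\<omega> \<in> space (F t)"
      hence 1: "1 \<le> \<tau> i \<omega>" using ge1[OF True] by simp
      show "(\<Sum>s<t. if \<tau> i \<omega> = enat (Suc s) then X (Suc s) \<omega> else 0) = Y t \<omega> i"
      proof (cases "\<tau> i \<omega>")
        case (enat n)
        then obtain m where n: "n = Suc m" using 1 by (cases n) (auto simp: one_enat_def)
        have "(\<Sum>s<t. if \<tau> i \<omega> = enat (Suc s) then X (Suc s) \<omega> else 0) = (\<Sum>s<t. if s = m then X (Suc s) \<omega> else 0)"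
          by (intro sum.cong) (auto simp: enat n)
        thus ?thesis using True by (simp add: Y_def enat n Suc_le_eq)
      qed (simp add: Y_def)
    qed
    finally show ?thesis .
  qed (simp add: Y_def)
  have path: "AE \<omega> in M. (\<forall>t. (N t \<omega> < k \<longleftrightarrow> enat t < \<tau> (k - 1) \<omega>) \<and> consistent 0 1 (placed \<pi> (N t \<omega>) (Y t \<omega>))) \<and>
      ennreal (pattern_cost \<pi>) \<le> (\<Sum>t. ennreal (gain \<pi> (N t \<omega>) (Y t \<omega>) (X (Suc t) \<omega>)))"
    using fin AE_X AE_space
  proof eventually_elim
    case (elim \<omega>)
    define T where "T i = the_enat (\<tau> i \<omega>)" for i
    define x where "x i = X (T i) \<omega>" for i
    have T: "\<tau> i \<omega> = enat (T i)" if "i < k" for i using elim that by (auto simp: T_def)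
    have T1: "1 \<le> T i" if "i < k" for i
      using ge1[OF that elim(3)] T[OF that] by (simp add: one_enat_def)
    have Tinc: "T i < T j" if "i < j" "j < k" for i j
      using incr[OF that elim(3)] T[of i] T[of j] that by auto
    have cons: "consistent 0 1 (placed \<pi> j x)" if "j \<le> k" for j
      using elim T1 that by (auto simp: consistent_placed x_def T_def)
    \<comment> \<open>The embedding times increase, so the entries present at time \<open>t\<close> are the first ones.\<close>
    have Nset: "{..<N t \<omega>} = {i. i < k \<and> T i \<le> t}" for t
    proof -
      have "{i. i < k \<and> T i \<le> t} = {..<card {i. i < k \<and> T i \<le> t}}"
        by (rule downclosed_eq_lessThan_card) (use Tinc in \<open>auto, metis less_imp_le order_trans\<close>)
      moreover have "{i. i < k \<and> \<tau> i \<omega> \<le> enat t} = {i. i < k \<and> T i \<le> t}" using T by auto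
      ultimately show ?thesis by (simp add: N_def)
    qed
    hence Niff: "i < N t \<omega> \<longleftrightarrow> i < k \<and> T i \<le> t" for i t by blast
    have Nk: "N t \<omega> \<le> k" for t using Niff[of k t] by auto
    have Yx: "Y t \<omega> i = x i" if "i < N t \<omega>" for t i
    proof -
      have "i < k" "T i \<le> t" using that by (auto simp: Niff)
      thus ?thesis using T[of i] by (simp add: Y_def x_def)
    qed
    have "N t \<omega> < k \<longleftrightarrow> enat t < \<tau> (k - 1) \<omega>" for t
      using Niff[of "k - 1" t] T[of "k - 1"] k Nk[of t] by auto
    moreover have "consistent 0 1 (placed \<pi> (N t \<omega>) (Y t \<omega>))" for t
      using cons[OF Nk] placed_cong[of "N t \<omega>" "Y t \<omega>" x \<pi>] Yx by simp
    moreover have "ennreal (pattern_cost \<pi>) \<le> (\<Sum>t. ennreal (gain \<pi> (N t \<omega>) (Y t \<omega>) (X (Suc t) \<omega>)))"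
    proof -
      let ?h = "\<lambda>t. ennreal (gain \<pi> (N t \<omega>) (Y t \<omega>) (X (Suc t) \<omega>))"
      \<comment> \<open>Just before \<open>T i\<close> exactly \<open>i\<close> entries are present; this also makes the times \<open>T i - 1\<close> distinct.\<close>
      have Ni: "N (T i - 1) \<omega> = i" if i: "i < k" for i
      proof -
        have "{i'. i' < k \<and> T i' \<le> T i - 1} = {..<i}"
        proof (intro equalityI subsetI)
          fix i' assume "i' \<in> {i'. i' < k \<and> T i' \<le> T i - 1}"
          hence "i' < k" "T i' < T i" using T1[OF i] by auto
          thus "i' \<in> {..<i}" using Tinc[of i i'] by (cases i i' rule: linorder_cases) auto
        next
          fix i' assume "i' \<in> {..<i}"
          thus "i' \<in> {i'. i' < k \<and> T i' \<le> T i - 1}" using Tinc[of i' i] i by auto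
        qed
        thus ?thesis using Nset[of "T i - 1"] by auto
      qed
      have "ennreal (pattern_cost \<pi>) \<le> (\<Sum>i<k. ennreal (gain \<pi> i x (x i)))"
        unfolding k_def by (rule pattern_cost_le_sum_gains) (use cons[of k] in \<open>simp add: k_def\<close>)
      also have "\<dots> = (\<Sum>i<k. ?h (T i - 1))"
      proof (rule sum.cong)
        fix i assume "i \<in> {..<k}"
        hence i: "i < k" by simp
        have "Suc (T i - 1) = T i" using T1[OF i] by simp
        moreover have "gain \<pi> i (Y (T i - 1) \<omega>) (x i) = gain \<pi> i x (x i)"
          by (rule gain_cong, rule Yx) (simp only: Ni[OF i])
        ultimately show "ennreal (gain \<pi> i x (x i)) = ?h (T i - 1)"
          by (simp only: Ni[OF i] x_def[of i, symmetric])
      qed simp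
      also have "\<dots> = sum ?h ((\<lambda>i. T i - 1) ` {..<k})"
      proof (subst sum.reindex)
        show "inj_on (\<lambda>i. T i - 1) {..<k}"
          by (rule inj_onI) (metis Ni lessThan_iff)
      qed simp
      also have "\<dots> \<le> (\<Sum>t. ?h t)"
        by (rule sum_le_suminf) auto
      finally show ?thesis .
    qed
    ultimately show ?case by blast
  qed
  have N' [measurable]: "N t \<in> measurable M (count_space UNIV)" for t
    by (rule measurable_filtrationD[OF N])
  have gm: "(\<lambda>\<omega>. gain \<pi> (N t \<omega>) (Y t \<omega>) (X (Suc t) \<omega>)) \<in> borel_measurable M" for t
    by (rule measurable_compose_countable[where f = "\<lambda>j \<omega>. gain \<pi> j (Y t \<omega>) (X (Suc t) \<omega>)"])
       (auto intro!: measurable_gain X_measurable measurable_filtrationD[OF Y])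
  have "ennreal (pattern_cost \<pi>) = (\<integral>\<^sup>+\<omega>. ennreal (pattern_cost \<pi>) \<partial>M)"
    by (simp add: emeasure_space_1)
  also have "\<dots> \<le> (\<integral>\<^sup>+\<omega>. (\<Sum>t. ennreal (gain \<pi> (N t \<omega>) (Y t \<omega>) (X (Suc t) \<omega>))) \<partial>M)"
    by (rule nn_integral_mono_AE) (use path in \<open>auto elim: eventually_mono\<close>)
  also have "\<dots> = (\<Sum>t. \<integral>\<^sup>+\<omega>. ennreal (gain \<pi> (N t \<omega>) (Y t \<omega>) (X (Suc t) \<omega>)) \<partial>M)"
    by (rule nn_integral_suminf) (use gm in auto)
  also have "\<dots> = (\<Sum>t. emeasure M {\<omega> \<in> space M. N t \<omega> < length \<pi>})"
  proof (rule suminf_cong)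
    fix t
    show "(\<integral>\<^sup>+\<omega>. ennreal (gain \<pi> (N t \<omega>) (Y t \<omega>) (X (Suc t) \<omega>)) \<partial>M) = emeasure M {\<omega> \<in> space M. N t \<omega> < length \<pi>}"
      by (rule expected_gain[OF \<pi>(1) N Y]) (use path in \<open>auto elim: eventually_mono\<close>)
  qed
  also have "\<dots> = (\<Sum>t. emeasure M {\<omega> \<in> space M. enat t < \<tau> (k - 1) \<omega>})"
  proof (rule suminf_cong, rule emeasure_eq_AE)
    fix t
    have m: "\<tau> (k - 1) \<in> measurable M (count_space UNIV)"
      by (rule measurable_stopping_time[OF st]) (use k in simp)
    show "AE \<omega> in M. \<omega> \<in> {\<omega> \<in> space M. N t \<omega> < length \<pi>} \<longleftrightarrow> \<omega> \<in> {\<omega> \<in> space M. enat t < \<tau> (k - 1) \<omega>}"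
      using path by (auto simp: k_def elim!: eventually_mono)
    show "{\<omega> \<in> space M. N t \<omega> < length \<pi>} \<in> sets M" by measurable
    show "{\<omega> \<in> space M. enat t < \<tau> (k - 1) \<omega>} \<in> sets M"
      using measurable_sets[OF m, of "{enat t<..}"] by (simp add: vimage_def Int_def conj_commute)
  qed
  also have "\<dots> = (\<integral>\<^sup>+\<omega>. ennreal_of_enat (last \<tau>s \<omega>) \<partial>M)"
    unfolding last by (rule expectation_stopping_time[OF st, symmetric]) (use k in simp)
  finally show ?thesis .
qed

end

section \<open>The greedy algorithm attains the bound\<close>

text \<open>The optimal rule, as a function of a deterministic sample sequence \<open>z\<close>: accept exactly those
samples that strictly lower the potential.\<close>

primrec greedy :: "nat list \<Rightarrow> (nat \<Rightarrow> real) \<Rightarrow> nat \<Rightarrow> nat \<times> (nat \<Rightarrow> real)" where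
  "greedy \<pi> z 0 = (0, \<lambda>_. 0)"
| "greedy \<pi> z (Suc t) = (case greedy \<pi> z t of (j, x) \<Rightarrow>
     if 0 < gain \<pi> j x (z (Suc t)) then (Suc j, x(j := z (Suc t))) else (j, x))"

abbreviation "greedy_count \<pi> z t \<equiv> fst (greedy \<pi> z t)"
abbreviation "greedy_values \<pi> z t \<equiv> snd (greedy \<pi> z t)"

definition greedy_time :: "nat list \<Rightarrow> (nat \<Rightarrow> real) \<Rightarrow> nat \<Rightarrow> enat" where
  "greedy_time \<pi> z i =
     (if \<exists>t. i < greedy_count \<pi> z t then enat (LEAST t. i < greedy_count \<pi> z t) else \<infinity>)"

lemma gain_posD:
  assumes "0 < gain \<pi> j x y"
  shows "j < length \<pi>" "consistent 0 1 (placed \<pi> (Suc j) (x(j := y)))"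
    "state_potential \<pi> j x = state_potential \<pi> (Suc j) (x(j := y)) + gain \<pi> j x y"
  using assms by (auto simp: gain_def split: if_splits)

lemma greedy_invariant:
  "greedy_count \<pi> z t \<le> length \<pi> \<and> consistent 0 1 (placed \<pi> (greedy_count \<pi> z t) (greedy_values \<pi> z t))"
proof (induction t)
  case 0 thus ?case by (simp add: consistent_def)
next
  case (Suc t)
  obtain j x where jx: "greedy \<pi> z t = (j, x)" by fastforce
  show ?case
  proof (cases "0 < gain \<pi> j x (z (Suc t))")
    case True
    hence "greedy \<pi> z (Suc t) = (Suc j, x(j := z (Suc t)))" by (simp add: jx)
    thus ?thesis using gain_posD(1,2)[OF True] by (simp only: fst_conv snd_conv Suc_leI)
  qed (use Suc jx in simp)
qed

lemma greedy_count_mono: "s \<le> t \<Longrightarrow> greedy_count \<pi> z s \<le> greedy_count \<pi> z t"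
  by (rule lift_Suc_mono_le) (auto split: prod.splits)

lemma greedy_count_Suc_le: "greedy_count \<pi> z (Suc t) \<le> Suc (greedy_count \<pi> z t)"
  by (auto split: prod.splits)

lemma greedy_values_keep:
  assumes "i < greedy_count \<pi> z s" "s \<le> t"
  shows "greedy_values \<pi> z t i = greedy_values \<pi> z s i"
  using assms(2)
proof (induction rule: dec_induct)
  case (step t)
  have "i < greedy_count \<pi> z t" using assms(1) greedy_count_mono[OF step(1)] by (rule less_le_trans)
  thus ?case using step(3) by (auto split: prod.splits)
qed simp

text \<open>The greedy rule collects every positive part that is offered, so potential plus collected gains
stays equal to the initial cost; the potential is nonnegative.\<close>

lemma greedy_sum_gains:
  "(\<Sum>s<t. ennreal (gain \<pi> (greedy_count \<pi> z s) (greedy_values \<pi> z s) (z (Suc s)))) \<le> ennreal (pattern_cost \<pi>)"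
proof -
  have "ennreal (state_potential \<pi> (greedy_count \<pi> z t) (greedy_values \<pi> z t)) +
      (\<Sum>s<t. ennreal (gain \<pi> (greedy_count \<pi> z s) (greedy_values \<pi> z s) (z (Suc s)))) = ennreal (pattern_cost \<pi>)"
  proof (induction t)
    case (Suc t)
    obtain j x where jx: "greedy \<pi> z t = (j, x)" by fastforce
    let ?y = "z (Suc t)"
    have pos: "0 \<le> state_potential \<pi> (greedy_count \<pi> z (Suc t)) (greedy_values \<pi> z (Suc t))"
      unfolding state_potential_def
      by (rule potential_nonneg, rule greedy_invariant[THEN conjunct2]) simp
    have step: "ennreal (state_potential \<pi> (greedy_count \<pi> z (Suc t)) (greedy_values \<pi> z (Suc t))) + ennreal (gain \<pi> j x ?y) =
        ennreal (state_potential \<pi> j x)"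
    proof (cases "0 < gain \<pi> j x ?y")
      case True
      with pos jx show ?thesis by (simp add: gain_posD(3) ennreal_plus[symmetric] del: ennreal_plus)
    qed (simp add: jx ennreal_neg)
    have swap: "a + (b + c) = (a + c) + b" for a b c :: ennreal by (simp add: ac_simps)
    show ?case
      using Suc by (simp only: sum.lessThan_Suc jx fst_conv snd_conv swap step)
  qed simp
  from this[symmetric] show ?thesis by (simp only:) (rule add_increasing; simp)
qed

lemma greedy_time_le_iff: "greedy_time \<pi> z i \<le> enat t \<longleftrightarrow> i < greedy_count \<pi> z t"
proof
  assume a: "greedy_time \<pi> z i \<le> enat t"
  hence ex: "\<exists>t. i < greedy_count \<pi> z t" by (auto simp: greedy_time_def split: if_splits)
  from LeastI_ex[OF ex] a ex show "i < greedy_count \<pi> z t"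
    using greedy_count_mono[of _ t \<pi> z] by (auto simp: greedy_time_def intro: less_le_trans)
next
  assume a: "i < greedy_count \<pi> z t"
  thus "greedy_time \<pi> z i \<le> enat t"
    using Least_le[of "\<lambda>t. i < greedy_count \<pi> z t", OF a] by (auto simp: greedy_time_def)
qed

text \<open>The count grows by at most 1 per step, so at the time \<open>t\<close> at which it first exceeds \<open>i\<close> it was
\<open>i\<close> just before, and the sample \<open>z t\<close> was stored at position \<open>i\<close>.\<close>

lemma greedy_time_eqD:
  assumes "greedy_time \<pi> z i = enat t"
  shows "\<exists>s. t = Suc s \<and> greedy_count \<pi> z s = i \<and> greedy_values \<pi> z t i = z t \<and> i < greedy_count \<pi> z t"
proof -
  have t: "i < greedy_count \<pi> z t" using greedy_time_le_iff[of \<pi> z i t] assms by simp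
  then obtain s where s: "t = Suc s" by (cases t) auto
  have "\<not> i < greedy_count \<pi> z s" using greedy_time_le_iff[of \<pi> z i s] assms s by simp
  hence "greedy_count \<pi> z s = i" using t s greedy_count_Suc_le[of \<pi> z s] by simp
  thus ?thesis using t s by (auto split: prod.splits if_splits)
qed

lemma greedy_time_less:
  assumes "i < j"
  shows "greedy_time \<pi> z i < greedy_time \<pi> z j \<or> greedy_time \<pi> z i = \<infinity> \<and> greedy_time \<pi> z j = \<infinity>"
proof (cases "greedy_time \<pi> z j")
  case (enat t)
  then obtain s where s: "t = Suc s" "greedy_count \<pi> z s = j" using greedy_time_eqD by blast
  hence "greedy_time \<pi> z i \<le> enat s" using assms by (simp add: greedy_time_le_iff)
  also have "\<dots> < enat t" by (simp add: s)
  finally show ?thesis using enat by simp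
next
  case infinity thus ?thesis by (cases "greedy_time \<pi> z i") auto
qed

text \<open>Stored values are never overwritten, so once all times are finite the final state holds the
accepted samples, and its consistency is the claim.\<close>

lemma greedy_order_isomorphic:
  assumes "distinct \<pi>" "\<And>i. i < length \<pi> \<Longrightarrow> greedy_time \<pi> z i \<noteq> \<infinity>"
  shows "order_isomorphic (map (\<lambda>i. z (the_enat (greedy_time \<pi> z i))) [0..<length \<pi>]) \<pi>"
proof -
  define x where "x i = z (the_enat (greedy_time \<pi> z i))" for i
  have "\<pi> ! i < \<pi> ! j \<longrightarrow> x i < x j" if "i < length \<pi>" "j < length \<pi>" for i j
  proof -
    let ?k = "length \<pi>"
    have "?k - 1 < ?k" using that by auto
    from assms(2)[OF this] obtain t where t: "greedy_time \<pi> z (?k - 1) = enat t" by blast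
    hence "?k - 1 < greedy_count \<pi> z t" using greedy_time_eqD by blast
    hence n: "greedy_count \<pi> z t = ?k" using greedy_invariant[of \<pi> z t] by auto
    have v: "greedy_values \<pi> z t l = x l" if "l < ?k" for l
    proof -
      obtain s where s: "greedy_time \<pi> z l = enat s" using assms(2)[OF \<open>l < ?k\<close>] by auto
      have "s \<le> t" using greedy_time_le_iff[of \<pi> z l t] s n that by simp
      thus ?thesis using greedy_time_eqD[OF s] greedy_values_keep[of l \<pi> z s t] s by (auto simp: x_def)
    qed
    show ?thesis using greedy_invariant[of \<pi> z t] n v that by (auto simp: consistent_placed)
  qed
  moreover have "\<pi> ! i \<noteq> \<pi> ! j" if "i < length \<pi>" "j < length \<pi>" "i \<noteq> j" for i j
    using assms(1) that by (simp add: nth_eq_iff_index_eq)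
  ultimately have "x i < x j \<longleftrightarrow> \<pi> ! i < \<pi> ! j" if "i < length \<pi>" "j < length \<pi>" for i j
    using that by (metis less_asym less_irrefl linorder_neqE_nat)
  thus ?thesis by (simp add: order_isomorphic_def x_def)
qed

context uniform_stream
begin

lemma greedy_measurable:
  "(\<lambda>\<omega>. greedy_count \<pi> (\<lambda>s. X s \<omega>) t) \<in> measurable (F t) (count_space UNIV)"
  "(\<lambda>\<omega>. greedy_values \<pi> (\<lambda>s. X s \<omega>) t i) \<in> borel_measurable (F t)"
proof (induction t arbitrary: i)
  case (Suc t)
  let ?n = "\<lambda>\<omega>. greedy_count \<pi> (\<lambda>s. X s \<omega>) t" and ?x = "\<lambda>\<omega>. greedy_values \<pi> (\<lambda>s. X s \<omega>) t"
  have n [measurable]: "?n \<in> measurable (F (Suc t)) (count_space UNIV)"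
    by (rule measurable_filtration_mono[OF _ Suc(1)]) simp
  have x [measurable]: "(\<lambda>\<omega>. ?x \<omega> i) \<in> borel_measurable (F (Suc t))" for i
    by (rule measurable_filtration_mono[OF _ Suc(2)]) simp
  have X [measurable]: "X (Suc t) \<in> borel_measurable (F (Suc t))"
    by (rule X_measurable_filtration) auto
  have [measurable]: "(\<lambda>\<omega>. gain \<pi> (?n \<omega>) (?x \<omega>) (X (Suc t) \<omega>)) \<in> borel_measurable (F (Suc t))"
    by (rule measurable_compose_countable[where f = "\<lambda>j \<omega>. gain \<pi> j (?x \<omega>) (X (Suc t) \<omega>)", OF measurable_gain[OF x X] n])
  {
    case 1
    have "(\<lambda>\<omega>. greedy_count \<pi> (\<lambda>s. X s \<omega>) (Suc t)) =
        (\<lambda>\<omega>. if 0 < gain \<pi> (?n \<omega>) (?x \<omega>) (X (Suc t) \<omega>) then Suc (?n \<omega>) else ?n \<omega>)"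
      by (auto split: prod.splits)
    thus ?case by simp
  next
    case 2
    have "(\<lambda>\<omega>. greedy_values \<pi> (\<lambda>s. X s \<omega>) (Suc t) i) =
        (\<lambda>\<omega>. if 0 < gain \<pi> (?n \<omega>) (?x \<omega>) (X (Suc t) \<omega>) \<and> ?n \<omega> = i then X (Suc t) \<omega> else ?x \<omega> i)"
      by (auto split: prod.splits)
    thus ?case by simp
  }
qed simp_all

lemma stopping_time_greedy:
  "stopping_time (natural_filtration M X) (\<lambda>\<omega>. greedy_time \<pi> (\<lambda>s. X s \<omega>) i)"
  unfolding stopping_time_def
proof
  fix t
  show "Measurable.pred (natural_filtration M X t) (\<lambda>\<omega>. greedy_time \<pi> (\<lambda>s. X s \<omega>) i \<le> t)"
  proof (cases t)
    case (enat n)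
    note [measurable] = greedy_measurable(1)[of \<pi> n]
    show ?thesis unfolding enat greedy_time_le_iff by measurable
  qed simp
qed

text \<open>The bound on the expected duration comes first; almost sure finiteness of the greedy times, and
with it the fact that they form an online algorithm, is a consequence of it.\<close>

lemma pattern_cost_upper:
  assumes \<pi>: "distinct \<pi>" "\<pi> \<noteq> []"
  shows "\<exists>\<tau>s\<in>online_algorithms M X \<pi>. (\<integral>\<^sup>+\<omega>. ennreal_of_enat (last \<tau>s \<omega>) \<partial>M) \<le> ennreal (pattern_cost \<pi>)"
proof -
  define k where "k = length \<pi>"
  have k: "0 < k" using \<pi> by (simp add: k_def)
  define \<tau> where "\<tau> i \<omega> = greedy_time \<pi> (\<lambda>s. X s \<omega>) i" for i \<omega>
  define \<tau>s where "\<tau>s = map \<tau> [0..<k]"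
  have st: "stopping_time (natural_filtration M X) (\<tau> i)" for i
    unfolding \<tau>_def[abs_def] by (rule stopping_time_greedy)
  let ?n = "\<lambda>t \<omega>. greedy_count \<pi> (\<lambda>s. X s \<omega>) t" and ?x = "\<lambda>t \<omega>. greedy_values \<pi> (\<lambda>s. X s \<omega>) t"
  let ?g = "\<lambda>t \<omega>. gain \<pi> (?n t \<omega>) (?x t \<omega>) (X (Suc t) \<omega>)"
  have iff: "enat t < \<tau> (k - 1) \<omega> \<longleftrightarrow> ?n t \<omega> < length \<pi>" for t \<omega>
  proof -
    have "enat t < \<tau> (k - 1) \<omega> \<longleftrightarrow> \<not> k - 1 < ?n t \<omega>"
      unfolding \<tau>_def greedy_time_le_iff[symmetric] by (simp add: not_le)
    thus ?thesis using k unfolding k_def by linarith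
  qed
  have gm: "?g t \<in> borel_measurable M" for t
    by (rule measurable_compose_countable[where f = "\<lambda>j \<omega>. gain \<pi> j (?x t \<omega>) (X (Suc t) \<omega>)"])
       (auto intro!: measurable_gain X_measurable measurable_filtrationD[OF greedy_measurable(1)]
          measurable_filtrationD[OF greedy_measurable(2)])
  have "(\<integral>\<^sup>+\<omega>. ennreal_of_enat (\<tau> (k - 1) \<omega>) \<partial>M) = (\<Sum>t. emeasure M {\<omega> \<in> space M. ?n t \<omega> < length \<pi>})"
    unfolding expectation_stopping_time[OF st] iff ..
  also have "\<dots> = (\<Sum>t. \<integral>\<^sup>+\<omega>. ennreal (?g t \<omega>) \<partial>M)"
    using greedy_invariant
    by (intro suminf_cong expected_gain[OF \<pi>(1) greedy_measurable, symmetric]) auto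
  also have "\<dots> = (\<integral>\<^sup>+\<omega>. (\<Sum>t. ennreal (?g t \<omega>)) \<partial>M)"
    by (rule nn_integral_suminf[symmetric]) (use gm in auto)
  also have "\<dots> \<le> (\<integral>\<^sup>+\<omega>. ennreal (pattern_cost \<pi>) \<partial>M)"
    by (intro nn_integral_mono suminf_le_const summableI) (rule greedy_sum_gains)
  also have "\<dots> = ennreal (pattern_cost \<pi>)" by (simp add: emeasure_space_1)
  finally have cost: "(\<integral>\<^sup>+\<omega>. ennreal_of_enat (\<tau> (k - 1) \<omega>) \<partial>M) \<le> ennreal (pattern_cost \<pi>)" .
  have fin: "AE \<omega> in M. \<forall>i<k. \<tau> i \<omega> \<noteq> \<infinity>"
  proof -
    note [measurable] = measurable_stopping_time[OF st]
    have "AE \<omega> in M. ennreal_of_enat (\<tau> (k - 1) \<omega>) \<noteq> \<infinity>"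
      by (rule nn_integral_PInf_AE) (use cost in \<open>auto simp: top_unique\<close>)
    thus ?thesis
    proof eventually_elim
      case (elim \<omega>)
      hence l: "\<tau> (k - 1) \<omega> \<noteq> \<infinity>" by (cases "\<tau> (k - 1) \<omega>") auto
      show ?case
      proof (intro allI impI)
        fix i assume "i < k"
        hence "i = k - 1 \<or> i < k - 1" by auto
        thus "\<tau> i \<omega> \<noteq> \<infinity>" using l greedy_time_less[of i "k - 1" \<pi> "\<lambda>s. X s \<omega>"]
          unfolding \<tau>_def by (metis enat_ord_simps(6))
      qed
    qed
  qed
  have "AE \<omega> in M. (\<forall>\<tau>\<in>set \<tau>s. \<tau> \<omega> \<noteq> \<infinity>) \<and> order_isomorphic (map (\<lambda>\<tau>. X (the_enat (\<tau> \<omega>)) \<omega>) \<tau>s) \<pi>"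
    using fin
  proof eventually_elim
    case (elim \<omega>)
    have "order_isomorphic (map (\<lambda>i. X (the_enat (greedy_time \<pi> (\<lambda>s. X s \<omega>) i)) \<omega>) [0..<length \<pi>]) \<pi>"
      by (rule greedy_order_isomorphic[OF \<pi>(1)]) (use elim in \<open>auto simp: \<tau>_def k_def\<close>)
    thus ?case using elim by (simp add: \<tau>s_def \<tau>_def k_def o_def)
  qed
  moreover have "1 \<le> \<tau> i \<omega>" for i \<omega>
  proof (cases "\<tau> i \<omega>")
    case (enat t) thus ?thesis using greedy_time_eqD[of \<pi> "\<lambda>s. X s \<omega>" i t] by (auto simp: \<tau>_def one_enat_def)
  qed simp
  moreover have "sorted_wrt (\<lambda>\<sigma> \<tau>. \<sigma> \<omega> < \<tau> \<omega> \<or> \<sigma> \<omega> = \<infinity> \<and> \<tau> \<omega> = \<infinity>) \<tau>s" for \<omega>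
    unfolding sorted_wrt_iff_nth_less \<tau>s_def \<tau>_def using greedy_time_less by auto
  ultimately have "\<tau>s \<in> online_algorithms M X \<pi>"
    using st unfolding online_algorithms_def by (auto simp: \<tau>s_def k_def)
  moreover have "last \<tau>s = \<tau> (k - 1)" using k by (simp add: \<tau>s_def last_map)
  ultimately show ?thesis using cost by (intro bexI[of _ \<tau>s]) auto
qed

theorem beta_eq_pattern_cost:
  assumes "distinct \<pi>"
  shows "beta M X \<pi> = ennreal (pattern_cost \<pi>)"
proof (cases "\<pi> = []")
  case False
  obtain \<tau>s where "\<tau>s \<in> online_algorithms M X \<pi>"
    "(\<integral>\<^sup>+\<omega>. ennreal_of_enat (last \<tau>s \<omega>) \<partial>M) \<le> ennreal (pattern_cost \<pi>)"
    using pattern_cost_upper[OF assms False] by blast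
  hence "(INF \<tau>s\<in>online_algorithms M X \<pi>. \<integral>\<^sup>+\<omega>. ennreal_of_enat (last \<tau>s \<omega>) \<partial>M) \<le> ennreal (pattern_cost \<pi>)"
    by (rule INF_lower2)
  moreover have "ennreal (pattern_cost \<pi>) \<le> (INF \<tau>s\<in>online_algorithms M X \<pi>. \<integral>\<^sup>+\<omega>. ennreal_of_enat (last \<tau>s \<omega>) \<partial>M)"
    by (intro INF_greatest pattern_cost_lower assms False)
  ultimately show ?thesis using False by (simp add: beta_def antisym)
qed (simp add: beta_def)

end

section \<open>The recursion for optimal embedding times\<close>

text \<open>The end points are the only places where a denominator may vanish in \<^typ>\<open>ennreal\<close>, and they
form a null set.\<close>

lemma split_integral_eq:
  assumes "0 \<le> l" "0 \<le> r" "0 \<le> a" "b \<le> 1"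
  shows "(\<integral>\<^sup>+x\<in>{a..b}. (ennreal l / ennreal x + ennreal r / ennreal (1 - x)) \<partial>lborel) =
         (\<integral>\<^sup>+x\<in>{a<..<b}. ennreal (split_cost l r x) \<partial>lborel)"
proof (rule nn_integral_cong_AE)
  show "AE x in lborel. (ennreal l / ennreal x + ennreal r / ennreal (1 - x)) * indicator {a..b} x =
      ennreal (split_cost l r x) * indicator {a<..<b} x"
    using AE_lborel_singleton[of a] AE_lborel_singleton[of b]
  proof eventually_elim
    case (elim x)
    have "ennreal l / ennreal x + ennreal r / ennreal (1 - x) = ennreal (split_cost l r x)" if "0 < x" "x < 1"
      using that assms by (simp add: split_cost_def divide_ennreal)
    thus ?case using elim assms by (auto simp: indicator_def)
  qed
qed

theorem theorem1p1:
  fixes M :: "'a measure" and X :: "nat \<Rightarrow> 'a \<Rightarrow> real" and \<pi> :: "nat list" and k :: nat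
  assumes "prob_space M"
    and "prob_space.indep_vars M (\<lambda>_. borel) X {1..}"
    and "\<And>i. i \<ge> 1 \<Longrightarrow> distr M borel (X i) = uniform_measure lborel {0..1}"
    and "k \<ge> 1" and "\<pi> \<in> permutations_of_set {1..k}"
  defines "S \<equiv> {1 / ennreal (b - a) + 1 / ennreal (b - a) *
      (\<integral>\<^sup>+ x\<in>{a..b}. (beta M X (left_perm \<pi>) / ennreal x
                    + beta M X (right_perm \<pi>) / ennreal (1 - x)) \<partial>lborel)
      | a b :: real. 0 \<le> a \<and> a < b \<and> b \<le> 1}"
  shows "beta M X \<pi> \<in> S \<and> (\<forall>y\<in>S. beta M X \<pi> \<le> y)"
proof -
  interpret uniform_stream M X
    by (intro uniform_stream.intro uniform_stream_axioms.intro assms)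
  have d: "distinct \<pi>" and "\<pi> \<noteq> []"
    using assms(4,5) by (auto simp: permutations_of_set_def)
  then obtain p ps where \<pi>: "\<pi> = p # ps" by (cases \<pi>) auto
  let ?L = "filter (\<lambda>q. q < p) ps" and ?R = "filter (\<lambda>q. p < q) ps"
  define l r where "l = pattern_cost ?L" and "r = pattern_cost ?R"
  have lr: "0 \<le> l" "0 \<le> r" by (auto simp: l_def r_def pattern_cost_nonneg)
  define c where "c = stop_level l r"
  have L: "beta M X (left_perm \<pi>) = ennreal l"
    using d unfolding left_perm_eq[OF assms(5,4)] by (subst beta_eq_pattern_cost) (auto simp: \<pi> l_def)
  have R: "beta M X (right_perm \<pi>) = ennreal r"
  proof -
    have "strict_mono_on (set ?R) (\<lambda>v. v - p)" by (auto simp: strict_mono_on_def)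
    moreover have "right_perm \<pi> = map (\<lambda>v. v - p) ?R"
      unfolding right_perm_eq[OF assms(5,4)] by (simp add: \<pi>)
    moreover have "distinct (map (\<lambda>v. v - p) ?R)" using d by (auto simp: \<pi> distinct_map inj_on_def)
    ultimately show ?thesis by (simp add: beta_eq_pattern_cost pattern_cost_map r_def)
  qed
  have c: "beta M X \<pi> = ennreal c"
    using beta_eq_pattern_cost[OF d] by (simp add: \<pi> c_def l_def r_def)
  let ?I = "\<lambda>a b. \<integral>\<^sup>+x\<in>{a<..<b}. ennreal (split_cost l r x) \<partial>lborel"
  define f where "f a b = 1 / ennreal (b - a) + 1 / ennreal (b - a) *
      (\<integral>\<^sup>+ x\<in>{a..b}. (ennreal l / ennreal x + ennreal r / ennreal (1 - x)) \<partial>lborel)" for a b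
  have f: "f a b = (1 + ?I a b) / ennreal (b - a)" if "0 \<le> a" "b \<le> 1" for a b
    unfolding f_def split_integral_eq[OF lr that] by (simp add: divide_ennreal_def distrib_left mult.commute)
  have S: "S = {f a b | a b. 0 \<le> a \<and> a < b \<and> b \<le> 1}"
    unfolding S_def L R f_def ..
  have div: "x * ennreal (b - a) / ennreal (b - a) = x" if "a < b" for x :: ennreal and a b :: real
    using that by (intro mult_divide_eq_ennreal) (auto simp: ennreal_eq_0_iff)
  show ?thesis
  proof
    obtain a b where ab: "0 \<le> a" "a < b" "b \<le> 1" and eq: "ennreal c * ennreal (b - a) = 1 + ?I a b"
      using stop_level_attained[OF lr] unfolding c_def by blast
    have "f a b = ennreal c" unfolding f[OF ab(1,3)] eq[symmetric] by (rule div[OF ab(2)])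
    thus "beta M X \<pi> \<in> S" unfolding S c using ab by force
    show "\<forall>y\<in>S. beta M X \<pi> \<le> y"
    proof
      fix y assume "y \<in> S"
      then obtain a b where ab: "0 \<le> a" "a < b" "b \<le> 1" and y: "y = f a b"
        unfolding S by blast
      show "beta M X \<pi> \<le> y"
        using divide_right_mono_ennreal[OF stop_level_lower[OF lr ab], of "ennreal (b - a)"]
        by (simp only: div[OF ab(2)] c c_def y f[OF ab(1,3)])
    qed
  qed
qed

end
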